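(* Let $p$ be an odd prime and let $G$ be a $p$-group of order $p^m$ of rank $5$ belonging to the isoclinism family $\Phi_8$. Then (1) $\displaystyle A_G(t/|G|)=\frac{1-p^{-2}}{1-p^{-2}t} + \frac{p^{-2}-p^{-4}}{1-p^{-1}t} + \frac{p^{-4}}{1-t}$; (2) $\displaystyle B_G(t/|G|)=\frac{-p^{-1}-p^{-2}}{1-p^{-3}t} + \frac{1+p^{-1}+p^{-2}}{1-p^{-2}t}$.
   Context: For a finite group $G$ and $n\ge 0$, $\alpha_{G,n}$ denotes the number of orbits of $G$ acting on $G^n$ by simultaneous conjugation $g\cdot(x_1,\dots,x_n)=(gx_1g^{-1},\dots,gx_ng^{-1})$, and $\beta_{G,n}$ denotes the number of orbits of the same action on the set $G^{(n)}$ of $n$-tuples of pairwise commuting elements of $G$; $\alpha_{G,0}=\beta_{G,0}=1$. Set $A_G(t)=\sum_{n\ge 0}\alpha_{G,n}t^n$ and $B_G(t)=\sum_{n\ge 0}\beta_{G,n}t^n$ (formal power series, which are rational functions of $t$). $A_G(t/|G|)$, $B_G(t/|G|)$ denote the result of substituting $t/|G|$ for $t$. Finite groups $G,H$ are isoclinic if there are isomorphisms $\theta:G/Z(G)\to H/Z(H)$ and $\phi:G'\to H'$ (derived subgroups) such that $\phi([g_1,g_2])=[h_1,h_2]$ whenever $\theta(g_iZ(G))=h_iZ(H)$ for $i=1,2$. Isoclinism is an equivalence relation, whose classes are called isoclinism families. For a $p$-group $G$, the rank of (the family of) $G$ is the smallest $r$ such that the isoclinism family of $G$ contains a group of order $p^r$.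 $\Phi_8$ (James's notation) is the isoclinism family, of rank 5, of the group of order $p^5$ $$\Phi_8(32)=\langle \alpha_1,\alpha_2, \beta\mid[\alpha_1,\alpha_2]=\beta=\alpha_1^p,\ \beta^{p^2}=\alpha_{2}^{p^2}=1 \rangle ,$$ with $[x,y]=x^{-1}y^{-1}xy$. $G$ belongs to $\Phi_8$ if $G$ is a finite $p$-group isoclinic to this group. *)

theory Defs
  imports
    "HOL-Algebra.Group_Action"
    "HOL-Algebra.Generated_Groups"
    "HOL-Computational_Algebra.Formal_Power_Series"
begin

section \<open>Orbits of simultaneous conjugation\<close>

definition tuples :: "('a, 'b) monoid_scheme \<Rightarrow> nat \<Rightarrow> 'a list set" where
  "tuples G n = {xs. length xs = n \<and> set xs \<subseteq> carrier G}"

definition commuting_tuples :: "('a, 'b) monoid_scheme \<Rightarrow> nat \<Rightarrow> 'a list set" where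
  "commuting_tuples G n =
     {xs \<in> tuples G n. \<forall>x\<in>set xs. \<forall>y\<in>set xs. x \<otimes>\<^bsub>G\<^esub> y = y \<otimes>\<^bsub>G\<^esub> x}"

text \<open>As required by the locale \<^locale>\<open>group_action\<close>, the action is restricted to the
  set \<open>E\<close> of tuples acted upon.\<close>

definition simul_conj :: "('a, 'b) monoid_scheme \<Rightarrow> 'a list set \<Rightarrow> 'a \<Rightarrow> 'a list \<Rightarrow> 'a list" where
  "simul_conj G E g = (\<lambda>xs\<in>E. map (\<lambda>x. g \<otimes>\<^bsub>G\<^esub> x \<otimes>\<^bsub>G\<^esub> inv\<^bsub>G\<^esub> g) xs)"

definition alpha :: "('a, 'b) monoid_scheme \<Rightarrow> nat \<Rightarrow> nat" where
  "alpha G n = card (orbits G (tuples G n) (simul_conj G (tuples G n)))"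

definition beta :: "('a, 'b) monoid_scheme \<Rightarrow> nat \<Rightarrow> nat" where
  "beta G n = card (orbits G (commuting_tuples G n) (simul_conj G (commuting_tuples G n)))"

definition A_series :: "('a, 'b) monoid_scheme \<Rightarrow> real fps" where
  "A_series G = Abs_fps (\<lambda>n. real (alpha G n))"

definition B_series :: "('a, 'b) monoid_scheme \<Rightarrow> real fps" where
  "B_series G = Abs_fps (\<lambda>n. real (beta G n))"


section \<open>Isoclinism\<close>

definition group_center :: "('a, 'b) monoid_scheme \<Rightarrow> 'a set" where
  "group_center G = {z \<in> carrier G. \<forall>x\<in>carrier G. z \<otimes>\<^bsub>G\<^esub> x = x \<otimes>\<^bsub>G\<^esub> z}"

definition commutator :: "('a, 'b) monoid_scheme \<Rightarrow> 'a \<Rightarrow> 'a \<Rightarrow> 'a" where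
  "commutator G x y = inv\<^bsub>G\<^esub> x \<otimes>\<^bsub>G\<^esub> inv\<^bsub>G\<^esub> y \<otimes>\<^bsub>G\<^esub> x \<otimes>\<^bsub>G\<^esub> y"

text \<open>\<^const>\<open>derived\<close> is generated by the elements $xyx^{-1}y^{-1}$. These are the same
  elements as the commutators $x^{-1}y^{-1}xy$, so this is the derived subgroup for both
  conventions.\<close>

definition derived_group :: "('a, 'b) monoid_scheme \<Rightarrow> ('a, 'b) monoid_scheme" where
  "derived_group G = G\<lparr>carrier := derived G (carrier G)\<rparr>"

definition isoclinic :: "('a, 'b) monoid_scheme \<Rightarrow> ('c, 'd) monoid_scheme \<Rightarrow> bool" where
  "isoclinic G H \<longleftrightarrow>
     (\<exists>\<theta> \<in> iso (G Mod group_center G) (H Mod group_center H).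
      \<exists>\<phi> \<in> iso (derived_group G) (derived_group H).
      \<forall>g\<^sub>1\<in>carrier G. \<forall>g\<^sub>2\<in>carrier G. \<forall>h\<^sub>1\<in>carrier H. \<forall>h\<^sub>2\<in>carrier H.
        \<theta> (group_center G #>\<^bsub>G\<^esub> g\<^sub>1) = group_center H #>\<^bsub>H\<^esub> h\<^sub>1 \<and>
        \<theta> (group_center G #>\<^bsub>G\<^esub> g\<^sub>2) = group_center H #>\<^bsub>H\<^esub> h\<^sub>2 \<longrightarrow>
        \<phi> (commutator G g\<^sub>1 g\<^sub>2) = commutator H h\<^sub>1 h\<^sub>2)"

text \<open>Every finite group is isomorphic to one whose elements are natural numbers, so
  letting \<open>H\<close> range over \<^typ>\<open>nat monoid\<close> is no restriction.\<close>

definition isoclinism_rank :: "nat \<Rightarrow> ('a, 'b) monoid_scheme \<Rightarrow> nat" where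
  "isoclinism_rank p G =
     (LEAST r. \<exists>H :: nat monoid. group H \<and> order H = p ^ r \<and> isoclinic G H)"


section \<open>Groups given by generators and relations\<close>

text \<open>The generators are all elements of the type \<open>'g\<close>. The letter \<open>(x, True)\<close> stands
  for $x$ and \<open>(x, False)\<close> for $x^{-1}$. A pair \<open>(u, v) \<in> R\<close> is the relation $u = v$.\<close>

type_synonym 'g word = "('g \<times> bool) list"

inductive pres_eq :: "('g word \<times> 'g word) set \<Rightarrow> 'g word \<Rightarrow> 'g word \<Rightarrow> bool"
  for R :: "('g word \<times> 'g word) set" where
  relation: "(u, v) \<in> R \<Longrightarrow> pres_eq R u v"
| cancel: "pres_eq R [(x, s), (x, \<not> s)] []"
| refl: "pres_eq R u u"
| sym: "pres_eq R u v \<Longrightarrow> pres_eq R v u"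
| trans: "pres_eq R u v \<Longrightarrow> pres_eq R v w \<Longrightarrow> pres_eq R u w"
| append: "pres_eq R u u' \<Longrightarrow> pres_eq R v v' \<Longrightarrow> pres_eq R (u @ v) (u' @ v')"

definition pres_class :: "('g word \<times> 'g word) set \<Rightarrow> 'g word \<Rightarrow> 'g word set" where
  "pres_class R u = {v. pres_eq R u v}"

definition presented_group :: "('g word \<times> 'g word) set \<Rightarrow> 'g word set monoid" where
  "presented_group R =
     \<lparr>carrier = range (pres_class R),
      monoid.mult = (\<lambda>U V. \<Union>u\<in>U. \<Union>v\<in>V. pres_class R (u @ v)),
      one = pres_class R []\<rparr>"

lemma pres_class_eq_iff: "pres_class R u = pres_class R v \<longleftrightarrow> pres_eq R u v"
proof
  assume "pres_class R u = pres_class R v"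
  then have "v \<in> pres_class R u" by (simp add: pres_class_def pres_eq.refl)
  then show "pres_eq R u v" by (simp add: pres_class_def)
next
  assume uv: "pres_eq R u v"
  have "pres_eq R u w \<longleftrightarrow> pres_eq R v w" for w
    using pres_eq.trans[OF uv] pres_eq.trans[OF pres_eq.sym[OF uv]] by blast
  then show "pres_class R u = pres_class R v" by (simp add: pres_class_def)
qed

lemma presented_group_mult:
  "pres_class R u \<otimes>\<^bsub>presented_group R\<^esub> pres_class R v = pres_class R (u @ v)"
proof -
  have "pres_class R (u' @ v') = pres_class R (u @ v)"
    if "u' \<in> pres_class R u" "v' \<in> pres_class R v" for u' v'
  proof -
    have "pres_eq R (u @ v) (u' @ v')"
      using that by (intro pres_eq.append) (simp_all add: pres_class_def)
    then show ?thesis by (simp add: pres_class_eq_iff pres_eq.sym)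
  qed
  moreover have "u \<in> pres_class R u" "v \<in> pres_class R v"
    by (simp_all add: pres_class_def pres_eq.refl)
  ultimately have "(\<Union>u'\<in>pres_class R u. \<Union>v'\<in>pres_class R v. pres_class R (u' @ v'))
      = pres_class R (u @ v)"
    by blast
  then show ?thesis by (simp add: presented_group_def)
qed

lemma carrier_presented_group: "carrier (presented_group R) = range (pres_class R)"
  by (simp add: presented_group_def)

lemma one_presented_group: "\<one>\<^bsub>presented_group R\<^esub> = pres_class R []"
  by (simp add: presented_group_def)

lemma group_presented_group: "group (presented_group R)"
proof (rule groupI)
  have inverse: "\<exists>v. pres_eq R (v @ u) []" for u :: "'a word"
  proof (induction u)
    case Nil
    show ?case by (rule exI[of _ "[]"]) (simp add: pres_eq.refl)
  next
    case (Cons a u)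
    obtain x s where a: "a = (x, s)" by (cases a)
    obtain v where v: "pres_eq R (v @ u) []" using Cons by blast
    have "pres_eq R [(x, \<not> s), (x, s)] []"
      using pres_eq.cancel[of R x "\<not> s"] by simp
    then have "pres_eq R (v @ [(x, \<not> s), (x, s)] @ u) (v @ [] @ u)"
      by (intro pres_eq.append pres_eq.refl)
    then have "pres_eq R ((v @ [(x, \<not> s)]) @ a # u) []"
      using pres_eq.trans[OF _ v] by (simp add: a)
    then show ?case by blast
  qed
  show "\<exists>y\<in>carrier (presented_group R). y \<otimes>\<^bsub>presented_group R\<^esub> x = \<one>\<^bsub>presented_group R\<^esub>"
    if x: "x \<in> carrier (presented_group R)" for x
  proof -
    obtain u where u: "x = pres_class R u"
      using x unfolding carrier_presented_group by (rule rangeE)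
    obtain v where "pres_eq R (v @ u) []" using inverse by blast
    then have "pres_class R v \<otimes>\<^bsub>presented_group R\<^esub> x = \<one>\<^bsub>presented_group R\<^esub>"
      unfolding u presented_group_mult by (simp add: one_presented_group pres_class_eq_iff)
    then show ?thesis by (auto simp: carrier_presented_group)
  qed
next
  fix x y assume "x \<in> carrier (presented_group R)" "y \<in> carrier (presented_group R)"
  then obtain u v where "x = pres_class R u" "y = pres_class R v"
    unfolding carrier_presented_group by blast
  then show "x \<otimes>\<^bsub>presented_group R\<^esub> y \<in> carrier (presented_group R)"
    by (simp add: presented_group_mult carrier_presented_group)
next
  show "\<one>\<^bsub>presented_group R\<^esub> \<in> carrier (presented_group R)"
    by (simp add: carrier_presented_group one_presented_group)
next
  fix x y z
  assume "x \<in> carrier (presented_group R)" "y \<in> carrier (presented_group R)"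
    "z \<in> carrier (presented_group R)"
  then obtain u v w where "x = pres_class R u" "y = pres_class R v" "z = pres_class R w"
    unfolding carrier_presented_group by blast
  then show "x \<otimes>\<^bsub>presented_group R\<^esub> y \<otimes>\<^bsub>presented_group R\<^esub> z =
      x \<otimes>\<^bsub>presented_group R\<^esub> (y \<otimes>\<^bsub>presented_group R\<^esub> z)"
    by (simp add: presented_group_mult)
next
  fix x assume "x \<in> carrier (presented_group R)"
  then obtain u where u: "x = pres_class R u" unfolding carrier_presented_group by (rule rangeE)
  show "\<one>\<^bsub>presented_group R\<^esub> \<otimes>\<^bsub>presented_group R\<^esub> x = x"
    by (simp add: u one_presented_group presented_group_mult)
qed


section \<open>The family $\Phi_8$\<close>

definition word_pow :: "'g \<Rightarrow> nat \<Rightarrow> 'g word" where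
  "word_pow x k = replicate k (x, True)"

definition word_commutator :: "'g \<Rightarrow> 'g \<Rightarrow> 'g word" where
  "word_commutator x y = [(x, False), (y, False), (x, True), (y, True)]"

datatype Phi8_gen = Alpha1 | Alpha2 | Beta

text \<open>Only the displayed relations are imposed: James's convention that omitted commutators of
  generators are trivial does not apply here, since $[\beta, \alpha_2] = \alpha_1^{p^2} \neq 1$
  in the intended group of order $p^5$.\<close>

definition Phi8_relations :: "nat \<Rightarrow> (Phi8_gen word \<times> Phi8_gen word) set" where
  "Phi8_relations p =
     {(word_commutator Alpha1 Alpha2, word_pow Beta 1),
      (word_pow Beta 1, word_pow Alpha1 p),
      (word_pow Beta (p ^ 2), []),
      (word_pow Alpha2 (p ^ 2), [])}"

definition Phi8_32 :: "nat \<Rightarrow> Phi8_gen word set monoid" where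
  "Phi8_32 p = presented_group (Phi8_relations p)"

definition p_group :: "nat \<Rightarrow> ('a, 'b) monoid_scheme \<Rightarrow> bool" where
  "p_group p G \<longleftrightarrow> group G \<and> (\<exists>m. order G = p ^ m)"

definition in_Phi8 :: "nat \<Rightarrow> ('a, 'b) monoid_scheme \<Rightarrow> bool" where
  "in_Phi8 p G \<longleftrightarrow> p_group p G \<and> isoclinic G (Phi8_32 p)"

end

theory Submission
  imports Defs "HOL-Number_Theory.Cong"
begin

text \<open>By Burnside's lemma, $|G|\alpha_{G,n}$ counts the tuples $(g, x_1, \dots, x_n)$ in which $g$
  commutes with every $x_i$, and $|G|\beta_{G,n}$ counts the commuting $(n+1)$-tuples. Both counts
  depend only on which cosets of the centre commute, so after division by a power of $|G|$ they are
  invariant under isoclinism, and one may replace $G$ by $K = \Phi_8(32)$. The elements of $K$ are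
  $\alpha_2^j \alpha_1^i$ with $j$ modulo $p^2$ and $i$ modulo $p^3$. Sending such an element to
  $(i, ((1+p)^j - 1)/p)$ identifies $K/Z(K)$ as a set with $V = (\mathbb{Z}/p^2)^2$, and two elements
  commute iff the determinant of their images vanishes modulo $p^2$. A vector outside $pV$ is
  orthogonal to exactly $p^2$ vectors, which are orthogonal to each other and of which $p$ lie in
  $pV$. A nonzero vector of $pV$ is orthogonal to $p^3$ vectors, among them all of $pV$.\<close>

section \<open>Counting lists\<close>

text \<open>The second coordinate comes from the commuting condition itself. For y^j x^i and y^l
  x^k, with x and y the generators alpha_1 and alpha_2, the x-exponents of the two products differ
  by i((1+p)^l - 1) - k((1+p)^j - 1) modulo p^3. Both terms are multiples of p, and division by p
  leaves a determinant modulo p^2. Oddness of p enters because j -> ((1+p)^j - 1)/p must permute the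
  residues modulo p^2. The coefficients of A are the proportions in V of the vectors outside pV, the
  nonzero vectors of pV, and 0; the poles come from the sizes p^2, p^3, p^4 of their orthogonal sets
  relative to |V| = p^4. For B, a pairwise orthogonal tuple either lies in pV or, having an entry
  outside pV, lies in exactly one of (p^4 - p^2)/(p^2 - p) = p^2 + p sets of p^2 vectors, each
  meeting pV in p vectors. Hence there are p^(2n) + (p^2 + p)(p^(2n) - p^n) such tuples of length n.
  This number at n + 1, divided by p^(4(n+1)), gives the two summands of B.\<close>

lemma card_lists_fibre:
  assumes "finite A" and "\<And>v. v \<in> V \<Longrightarrow> card {x \<in> A. f x = v} = z" and "set vs \<subseteq> V"
  shows "finite {xs. set xs \<subseteq> A \<and> map f xs = vs} \<and>
    card {xs. set xs \<subseteq> A \<and> map f xs = vs} = z ^ length vs"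
  using assms(3)
proof (induction vs)
  case Nil
  have "{xs. set xs \<subseteq> A \<and> map f xs = []} = {[]}" by auto
  then show ?case by simp
next
  case (Cons v vs)
  have eq: "{xs. set xs \<subseteq> A \<and> map f xs = v # vs} =
      (\<lambda>(x, xs). x # xs) ` ({x \<in> A. f x = v} \<times> {xs. set xs \<subseteq> A \<and> map f xs = vs})"
    by (auto simp: image_iff Cons_eq_map_conv map_eq_Cons_conv)
  have inj: "inj_on (\<lambda>(x, xs). x # xs) X" for X :: "('a \<times> 'a list) set"
    by (auto simp: inj_on_def)
  show ?case
    unfolding eq using Cons assms(1,2) by (simp add: card_image[OF inj] card_cartesian_product)
qed

text \<open>A property that sees only the images is constant on the fibres of \<open>map f\<close>,
  and a fibre over a list of length \<open>n\<close> has \<open>z ^ n\<close> elements, one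
  independent choice per entry.\<close>

lemma card_lists_vimage:
  assumes "finite A" and "finite V" and "f ` A \<subseteq> V"
    and "\<And>v. v \<in> V \<Longrightarrow> card {x \<in> A. f x = v} = z"
  shows "card {xs. set xs \<subseteq> A \<and> length xs = n \<and> P (map f xs)} =
    z ^ n * card {vs. set vs \<subseteq> V \<and> length vs = n \<and> P vs}"
proof -
  let ?S = "{vs. set vs \<subseteq> V \<and> length vs = n \<and> P vs}"
  let ?F = "\<lambda>vs. {xs. set xs \<subseteq> A \<and> map f xs = vs}"
  have F: "finite (?F vs) \<and> card (?F vs) = z ^ n" if "vs \<in> ?S" for vs
    using card_lists_fibre[OF assms(1,4), of V vs] that by auto
  have "finite ?S"
    by (rule finite_subset[OF _ finite_lists_length_eq[OF assms(2), of n]]) auto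
  then have "card (\<Union>vs\<in>?S. ?F vs) = (\<Sum>vs\<in>?S. card (?F vs))"
    using F by (intro card_UN_disjoint) auto
  also have "\<dots> = z ^ n * card ?S" using F by simp
  also have "(\<Union>vs\<in>?S. ?F vs) = {xs. set xs \<subseteq> A \<and> length xs = n \<and> P (map f xs)}"
    using assms(3) by (auto simp: image_subset_iff subset_iff)
  finally show ?thesis .
qed

lemma sum_fibres:
  fixes h :: "'b \<Rightarrow> nat"
  assumes "finite A" and "finite V" and "f ` A \<subseteq> V"
    and "\<And>v. v \<in> V \<Longrightarrow> card {x \<in> A. f x = v} = z"
  shows "(\<Sum>x\<in>A. h (f x)) = z * (\<Sum>v\<in>V. h v)"
  using sum_fun_comp[OF assms(1-3), of h] assms(4) by (simp add: sum_distrib_left)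

lemma card_vimage_fibres:
  assumes "finite A" and "finite V" and "f ` A \<subseteq> V"
    and "\<And>v. v \<in> V \<Longrightarrow> card {x \<in> A. f x = v} = z"
  shows "card {x \<in> A. Q (f x)} = z * card {v \<in> V. Q v}"
  using sum_fibres[OF assms, of "\<lambda>v. of_bool (Q v)"] assms(1,2)
  by (simp add: Int_def)

section \<open>Lists of pairwise related elements\<close>

definition related_lists :: "('a \<Rightarrow> 'a \<Rightarrow> bool) \<Rightarrow> 'a set \<Rightarrow> nat \<Rightarrow> 'a list set" where
  "related_lists R V n =
    {vs. set vs \<subseteq> V \<and> length vs = n \<and> (\<forall>x\<in>set vs. \<forall>y\<in>set vs. R x y)}"

text \<open>By \<open>trans\<close>, the elements related to a given \<open>u\<close> outside
  \<open>P\<close> are related to each other, so \<open>V - P\<close> splits into blocks of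
  \<open>a - b\<close> elements. A list not contained in \<open>P\<close> belongs to a single block,
  enlarged by \<open>b\<close> elements of \<open>P\<close>. The product form of the conclusion
  avoids counting the blocks by a division, and the second conclusion makes its truncated
  subtraction exact.\<close>

lemma card_related_lists:
  assumes fin: "finite V" and "P \<subseteq> V"
    and refl: "\<And>v. R v v" and sym: "\<And>v w. R v w \<Longrightarrow> R w v"
    and P: "\<And>v w. v \<in> P \<Longrightarrow> w \<in> P \<Longrightarrow> R v w"
    and trans: "\<And>u v w. u \<in> V - P \<Longrightarrow> v \<in> V \<Longrightarrow> w \<in> V \<Longrightarrow> R u v \<Longrightarrow> R u w \<Longrightarrow> R v w"
    and a: "\<And>u. u \<in> V - P \<Longrightarrow> card {w \<in> V. R u w} = a"
    and b: "\<And>u. u \<in> V - P \<Longrightarrow> card {w \<in> P. R u w} = b"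
  shows "(a - b) * (card (related_lists R V n) - card P ^ n) = card (V - P) * (a ^ n - b ^ n)"
    and "card P ^ n \<le> card (related_lists R V n)"
proof -
  let ?LP = "{vs. set vs \<subseteq> P \<and> length vs = n}"
  define T where "T = {vs \<in> related_lists R V n. \<not> set vs \<subseteq> P}"
  have finP: "finite P" using assms(1,2) finite_subset by blast
  have finR: "finite (related_lists R V n)" unfolding related_lists_def
    by (rule finite_subset[OF _ finite_lists_length_eq[OF fin, of n]]) auto
  have finLP: "finite ?LP" by (rule finite_lists_length_eq[OF finP])
  have LP: "?LP \<subseteq> related_lists R V n" using assms(2) P by (auto simp: related_lists_def subset_iff)
  have cLP: "card ?LP = card P ^ n" by (rule card_lists_length_eq[OF finP])
  have T: "T = related_lists R V n - ?LP" unfolding T_def related_lists_def by auto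
  have cT: "card T = card (related_lists R V n) - card P ^ n"
    unfolding T using card_Diff_subset[OF finLP LP] cLP by simp
  show "card P ^ n \<le> card (related_lists R V n)"
    using card_mono[OF finR LP] cLP by simp
  have finT: "finite T" unfolding T_def using finR by simp
  have 1: "card {u \<in> V - P. \<forall>x\<in>set vs. R u x} = a - b" if vs: "vs \<in> T" for vs
  proof -
    obtain x where x: "x \<in> set vs" "x \<in> V - P" and sub: "set vs \<subseteq> V"
      and rel: "\<And>y z. y \<in> set vs \<Longrightarrow> z \<in> set vs \<Longrightarrow> R y z"
      using vs unfolding T_def related_lists_def by auto
    \<comment> \<open>The entry \<open>x\<close> outside \<open>P\<close> decides: what is related
      to \<open>x\<close> is related to every entry of \<open>vs\<close>, by \<open>trans\<close>
      through \<open>x\<close>.\<close>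
    have "{u \<in> V - P. \<forall>x\<in>set vs. R u x} = {u \<in> V. R x u} - {u \<in> P. R x u}"
      using x sub rel trans sym by blast
    also have "card \<dots> = a - b"
      using assms(2) a[OF x(2)] b[OF x(2)] finP by (subst card_Diff_subset) auto
    finally show ?thesis .
  qed
  have 2: "card {vs \<in> T. \<forall>x\<in>set vs. R u x} = a ^ n - b ^ n" if u: "u \<in> V - P" for u
  proof -
    \<comment> \<open>Entries related to \<open>u\<close> are automatically pairwise related, so the
      only remaining restriction is that not all of them lie in \<open>P\<close>.\<close>
    have "{vs \<in> T. \<forall>x\<in>set vs. R u x} =
        {vs. set vs \<subseteq> {w \<in> V. R u w} \<and> length vs = n} - {vs. set vs \<subseteq> {w \<in> P. R u w} \<and> length vs = n}"
      (is "?l = ?A - ?B") using trans[OF u] unfolding T_def related_lists_def subset_iff by auto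
    moreover have "card (?A - ?B) = card ?A - card ?B"
      using assms(2) finP by (intro card_Diff_subset finite_lists_length_eq) auto
    ultimately show ?thesis
      using finP fin a[OF u] b[OF u] by (simp add: card_lists_length_eq)
  qed
  \<comment> \<open>Double counting of the pairs of \<open>u \<in> V - P\<close> and a list in \<open>T\<close> with all members related to \<open>u\<close>.\<close>
  have "(\<Sum>u\<in>V - P. card {vs \<in> T. \<forall>x\<in>set vs. R u x}) = (a - b) * card T"
    using 1 fin finT by (intro sum_multicount) auto
  then show "(a - b) * (card (related_lists R V n) - card P ^ n) = card (V - P) * (a ^ n - b ^ n)"
    using 2 cT by simp
qed

section \<open>The determinant form modulo $p^2$\<close>

text \<open>As \<open>a\<close> is invertible modulo \<open>k\<close>, the solutions form one
  residue class modulo \<open>k\<close>, and this class meets the \<open>k * m\<close> numbers in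
  \<open>m\<close> elements.\<close>

lemma card_linear_cong:
  fixes a k :: nat
  assumes "coprime a k" and "k > 0"
  shows "card {d. d < k * m \<and> [a * d = e] (mod k)} = m"
proof -
  obtain a' where a': "[a * a' = 1] (mod k)"
    using cong_solve_coprime_nat[OF assms(1)] by auto
  define c where "c = (a' * e) mod k"
  have iff: "[a * d = e] (mod k) \<longleftrightarrow> d mod k = c" for d
  proof -
    have "[d = a' * (a * d)] (mod k)"
      using cong_scalar_right[OF a', of d] by (simp add: cong_sym mult.left_commute mult.assoc)
    moreover have "[a * (a' * e) = e] (mod k)"
      using cong_scalar_right[OF a', of e] by (simp add: mult.assoc)
    ultimately have "[a * d = e] (mod k) \<longleftrightarrow> [d = a' * e] (mod k)"
      by (meson cong_scalar_left cong_trans cong_sym)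
    then show ?thesis by (simp add: c_def cong_def)
  qed
  have "c < k" unfolding c_def using assms(2) by simp
  have "{d. d < k * m \<and> [a * d = e] (mod k)} = (\<lambda>t. c + k * t) ` {..<m}"
  proof (intro Set.set_eqI iffI)
    fix d assume d: "d \<in> {d. d < k * m \<and> [a * d = e] (mod k)}"
    then have "d = c + k * (d div k)" using iff by auto
    moreover have "d div k < m" using d by (simp add: less_mult_imp_div_less mult.commute)
    ultimately show "d \<in> (\<lambda>t. c + k * t) ` {..<m}" by blast
  next
    fix d assume "d \<in> (\<lambda>t. c + k * t) ` {..<m}"
    then obtain t where t: "d = c + k * t" "t < m" by auto
    have "c + k * t < k * Suc t" using \<open>c < k\<close> by simp
    also have "\<dots> \<le> k * m" using t(2) by (intro mult_le_mono2) simp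
    finally show "d \<in> {d. d < k * m \<and> [a * d = e] (mod k)}"
      using t iff \<open>c < k\<close> by simp
  qed
  moreover have "inj_on (\<lambda>t. c + k * t) {..<m}" using assms(2) by (auto simp: inj_on_def)
  ultimately show ?thesis by (simp add: card_image)
qed

text \<open>The range is allowed to exceed the modulus by a factor \<open>m\<close> so that one
  count serves three cases: modulus p^2 on V, modulus p on V, and modulus p on pairs below
  p.\<close>

lemma card_linear_cong_pairs:
  fixes a b k :: nat
  assumes "coprime a k \<or> coprime b k" and "k > 0"
  shows "card {w \<in> {..<k * m} \<times> {..<k * m}. [a * snd w = b * fst w] (mod k)} = k * m * m"
proof -
  have *: "card {w \<in> {..<k * m} \<times> {..<k * m}. [a * snd w = b * fst w] (mod k)} = k * m * m"
    if "coprime a k" for a b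
  proof -
    have "{w \<in> {..<k * m} \<times> {..<k * m}. [a * snd w = b * fst w] (mod k)} =
        (SIGMA c:{..<k * m}. {d. d < k * m \<and> [a * d = b * c] (mod k)})" by auto
    then show ?thesis using card_linear_cong[OF that assms(2)] by simp
  qed
  show ?thesis
  proof (cases "coprime a k")
    case False
    have "card {w \<in> {..<k * m} \<times> {..<k * m}. [a * snd w = b * fst w] (mod k)} =
        card (prod.swap ` {w \<in> {..<k * m} \<times> {..<k * m}. [b * snd w = a * fst w] (mod k)})"
      by (rule arg_cong[where f = card]) (auto simp: image_iff cong_sym_eq)
    also have "\<dots> = k * m * m"
      using *[of b a] assms(1) False by (subst card_image) (auto simp: inj_on_def)
    finally show ?thesis .
  qed (use * in blast)
qed

definition det_cong :: "nat \<Rightarrow> nat \<times> nat \<Rightarrow> nat \<times> nat \<Rightarrow> bool" where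
  "det_cong p v w \<longleftrightarrow> [fst v * snd w = snd v * fst w] (mod p ^ 2)"

definition residue_pairs :: "nat \<Rightarrow> (nat \<times> nat) set" where
  "residue_pairs p = {..<p ^ 2} \<times> {..<p ^ 2}"

text \<open>This is pV. The parametrisation by pairs below \<open>p\<close> yields both its size and
  the quotient by \<open>p\<close> of each of its vectors.\<close>

definition divisible_pairs :: "nat \<Rightarrow> (nat \<times> nat) set" where
  "divisible_pairs p = (\<lambda>w. (p * fst w, p * snd w)) ` ({..<p} \<times> {..<p})"

lemma finite_residue_pairs: "finite (residue_pairs p)"
  by (simp add: residue_pairs_def)

lemma card_residue_pairs: "card (residue_pairs p) = p ^ 4"
  by (simp add: residue_pairs_def power_add[symmetric])

lemma det_cong_refl: "det_cong p v v"
  by (simp add: det_cong_def mult.commute)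

lemma det_cong_sym: "det_cong p v w \<Longrightarrow> det_cong p w v"
  by (auto simp: det_cong_def mult.commute intro: cong_sym)

lemma divisible_pairs_eq:
  "divisible_pairs p = {v \<in> residue_pairs p. p dvd fst v \<and> p dvd snd v}"
proof (intro Set.set_eqI iffI)
  fix v assume "v \<in> {v \<in> residue_pairs p. p dvd fst v \<and> p dvd snd v}"
  then have lt: "fst v < p * p" "snd v < p * p" and dvd: "p dvd fst v" "p dvd snd v"
    by (auto simp: residue_pairs_def power2_eq_square)
  obtain a b where "fst v = p * a" "snd v = p * b" using dvd unfolding dvd_def by blast
  with lt have v: "v = (p * a, p * b)" "p * a < p * p" "p * b < p * p" by (auto simp: prod_eq_iff)
  then have "(a, b) \<in> {..<p} \<times> {..<p}" by simp
  then show "v \<in> divisible_pairs p"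
    unfolding divisible_pairs_def by (intro image_eqI[of _ _ "(a, b)"]) (simp_all add: v(1))
qed (auto simp: divisible_pairs_def residue_pairs_def power2_eq_square)

context
  fixes p :: nat
  assumes prime_p: "Factorial_Ring.prime p"
begin

private lemma p_pos: "p > 0" by (rule prime_gt_0_nat[OF prime_p])

lemma card_divisible_pairs: "card (divisible_pairs p) = p ^ 2"
  unfolding divisible_pairs_def using p_pos
  by (subst card_image) (auto simp: inj_on_def power2_eq_square)

lemma det_cong_divisible_iff:
  "det_cong p (p * a, p * b) w \<longleftrightarrow> [a * snd w = b * fst w] (mod p)"
proof -
  have "[p * x = p * y] (mod p * p) \<longleftrightarrow> [x = y] (mod p)" for x y :: nat
    using p_pos by (simp add: cong_def mult_mod_right[symmetric])
  then show ?thesis by (simp add: det_cong_def power2_eq_square mult.assoc)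
qed

lemma det_cong_divisible:
  assumes "v \<in> divisible_pairs p" and "w \<in> divisible_pairs p"
  shows "det_cong p v w"
  using assms unfolding divisible_pairs_def by (auto simp: det_cong_divisible_iff cong_def)

lemma not_divisible_pairs_coprime:
  assumes "v \<in> residue_pairs p - divisible_pairs p"
  shows "coprime (fst v) p \<or> coprime (snd v) p"
  using assms prime_imp_coprime[OF prime_p] unfolding divisible_pairs_eq
  by (auto simp: coprime_commute[of _ p])

text \<open>The desired equation holds after multiplication by either coordinate of
  \<open>u\<close>, by combining the two hypotheses. One of the coordinates is a unit modulo p^2 and
  can be cancelled.\<close>

lemma det_cong_trans:
  assumes "u \<in> residue_pairs p - divisible_pairs p" and uv: "det_cong p u v" and uw: "det_cong p u w"
  shows "det_cong p v w"
proof -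
  obtain a b c d e f where [simp]: "u = (a, b)" "v = (c, d)" "w = (e, f)" by (cases u; cases v; cases w)
  have 1: "[a * d = b * c] (mod p ^ 2)" and 2: "[a * f = b * e] (mod p ^ 2)"
    using uv uw by (auto simp: det_cong_def)
  have "[a * (c * f) = b * c * e] (mod p ^ 2)" "[a * (d * e) = b * c * e] (mod p ^ 2)"
    using cong_scalar_left[OF 2, of c] cong_scalar_left[OF 1, of e] by (simp_all add: ac_simps)
  then have "[a * (c * f) = a * (d * e)] (mod p ^ 2)" by (rule cong_trans[OF _ cong_sym])
  moreover have "[b * (c * f) = a * d * f] (mod p ^ 2)" "[b * (d * e) = a * d * f] (mod p ^ 2)"
    using cong_sym[OF cong_scalar_left[OF 1, of f]] cong_sym[OF cong_scalar_left[OF 2, of d]]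
    by (simp_all add: ac_simps)
  then have "[b * (c * f) = b * (d * e)] (mod p ^ 2)" by (rule cong_trans[OF _ cong_sym])
  moreover have "coprime a (p ^ 2) \<or> coprime b (p ^ 2)"
    using not_divisible_pairs_coprime[OF assms(1)] by auto
  ultimately show ?thesis
    by (auto simp: det_cong_def cong_mult_lcancel_nat)
qed

text \<open>Both counts are linear congruences with a unit coefficient: over V with modulus p^2,
  and, once the factor p of the vectors of pV is cancelled, over pairs below p with modulus
  p.\<close>

lemma card_det_cong_not_divisible:
  assumes "v \<in> residue_pairs p - divisible_pairs p"
  shows "card {w \<in> residue_pairs p. det_cong p v w} = p ^ 2"
    and "card {w \<in> divisible_pairs p. det_cong p v w} = p"
proof -
  note co = not_divisible_pairs_coprime[OF assms]
  show "card {w \<in> residue_pairs p. det_cong p v w} = p ^ 2"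
    using card_linear_cong_pairs[of "fst v" "p ^ 2" "snd v" 1] co p_pos
    by (simp add: det_cong_def residue_pairs_def)
  have "{w \<in> divisible_pairs p. det_cong p v w} = (\<lambda>w. (p * fst w, p * snd w)) `
      {w \<in> {..<p} \<times> {..<p}. [fst v * snd w = snd v * fst w] (mod p)}"
  proof -
    have "det_cong p v (p * a, p * b) \<longleftrightarrow> [fst v * b = snd v * a] (mod p)" for a b
      using det_cong_divisible_iff[of a b v] det_cong_sym[of p v] det_cong_sym[of p _ v]
      by (metis cong_sym_eq mult.commute)
    then show ?thesis unfolding divisible_pairs_def by auto
  qed
  also have "card \<dots> = p"
    using card_linear_cong_pairs[of "fst v" p "snd v" 1] co p_pos
    by (subst card_image) (auto simp: inj_on_def)
  finally show "card {w \<in> divisible_pairs p. det_cong p v w} = p" .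
qed

text \<open>Cancelling the factor p of \<open>v\<close> leaves a condition modulo p on coordinates
  below p^2, hence \<open>card_linear_cong_pairs\<close> with k = m = p. The quotient of
  \<open>v\<close> has a unit coordinate because it is nonzero with entries below p.\<close>

lemma card_det_cong_divisible:
  assumes "v \<in> divisible_pairs p - {(0, 0)}"
  shows "card {w \<in> residue_pairs p. det_cong p v w} = p ^ 3"
proof -
  obtain a b where v: "v = (p * a, p * b)" "a < p" "b < p" "\<not> (a = 0 \<and> b = 0)"
    using assms unfolding divisible_pairs_def by force
  have "coprime a p \<or> coprime b p"
    using v(2-4) prime_imp_coprime[OF prime_p] by (metis coprime_commute nat_dvd_not_less neq0_conv)
  then show ?thesis
    using card_linear_cong_pairs[of a p b p] p_pos
    by (simp add: v(1) det_cong_divisible_iff residue_pairs_def power2_eq_square power3_eq_cube)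
qed

lemma sum_card_det_cong:
  "(\<Sum>v\<in>residue_pairs p. card {w \<in> residue_pairs p. det_cong p v w} ^ n) =
    (p ^ 4 - p ^ 2) * (p ^ 2) ^ n + (p ^ 2 - 1) * (p ^ 3) ^ n + (p ^ 4) ^ n"
proof -
  let ?V = "residue_pairs p" and ?P = "divisible_pairs p"
  let ?h = "\<lambda>v. card {w \<in> ?V. det_cong p v w} ^ n"
  have sub: "?P \<subseteq> ?V" by (auto simp: divisible_pairs_eq)
  have fin: "finite ?V" "finite ?P" using finite_subset[OF sub] finite_residue_pairs by auto
  have z: "(0, 0) \<in> ?P" using p_pos by (auto simp: divisible_pairs_eq residue_pairs_def)
  have "sum ?h ?V = sum ?h (?V - ?P) + (sum ?h (?P - {(0, 0)}) + ?h (0, 0))"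
    using fin sub z by (simp add: sum.subset_diff[of ?P ?V] sum.remove[of ?P "(0, 0)"])
  also have "sum ?h (?V - ?P) = (p ^ 4 - p ^ 2) * (p ^ 2) ^ n"
    using card_det_cong_not_divisible(1) card_Diff_subset[OF fin(2) sub]
    by (simp add: card_residue_pairs card_divisible_pairs)
  also have "sum ?h (?P - {(0, 0)}) = (p ^ 2 - 1) * (p ^ 3) ^ n"
    using card_det_cong_divisible z fin by (simp add: card_divisible_pairs)
  also have "?h (0, 0) = (p ^ 4) ^ n"
    by (simp add: det_cong_def card_residue_pairs)
  finally show ?thesis by simp
qed

lemma card_related_lists_det_cong:
  "real (card (related_lists (det_cong p) (residue_pairs p) n)) =
    (1 + real p + real p ^ 2) * (real p ^ 2) ^ n - (real p + real p ^ 2) * real p ^ n"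
proof -
  let ?V = "residue_pairs p" and ?P = "divisible_pairs p"
  have sub: "?P \<subseteq> ?V" by (auto simp: divisible_pairs_eq)
  have fin: "finite ?V" "finite ?P" using finite_subset[OF sub] finite_residue_pairs by auto
  note * = card_related_lists[of ?V ?P "det_cong p" "p ^ 2" p n, OF fin(1) sub det_cong_refl
      det_cong_sym det_cong_divisible det_cong_trans card_det_cong_not_divisible]
  let ?N = "card (related_lists (det_cong p) (residue_pairs p) n)"
  have "(p ^ 2 - p) * (?N - (p ^ 2) ^ n) = (p ^ 4 - p ^ 2) * ((p ^ 2) ^ n - p ^ n)"
    and le: "(p ^ 2) ^ n \<le> ?N"
    using * card_Diff_subset[OF fin(2) sub] by (simp_all add: card_residue_pairs card_divisible_pairs)
  \<comment> \<open>These inequalities make the truncated subtractions exact, so the equation may be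
    read in the reals.\<close>
  moreover have "p \<le> p ^ 2" "p ^ 2 \<le> p ^ 4" using p_pos by (auto intro: power_increasing self_le_power)
  moreover have "p ^ n \<le> (p ^ 2) ^ n" using p_pos by (intro power_mono self_le_power) auto
  ultimately have "(real p ^ 2 - p) * (?N - (real p ^ 2) ^ n) =
      (real p ^ 4 - p ^ 2) * ((real p ^ 2) ^ n - p ^ n)"
    by (metis (no_types, lifting) of_nat_diff of_nat_mult of_nat_power)
  \<comment> \<open>The factorisation p^4 - p^2 = (p^2 - p)(p^2 + p) exposes the nonzero factor p^2
    - p that is cancelled next.\<close>
  also have "\<dots> = (real p ^ 2 - p) * ((p + p ^ 2) * ((real p ^ 2) ^ n - p ^ n))"
    by (simp add: algebra_simps power2_eq_square power4_eq_xxxx)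
  finally have "real ?N - (real p ^ 2) ^ n = (p + p ^ 2) * ((real p ^ 2) ^ n - p ^ n)"
    using prime_gt_1_nat[OF prime_p] by (simp add: power2_eq_square)
  then show ?thesis by (simp add: algebra_simps)
qed

end

section \<open>Orbit counts and isoclinism\<close>

lemma (in group) conj_conj:
  assumes "g \<in> carrier G" "h \<in> carrier G" "x \<in> carrier G"
  shows "g \<otimes> (h \<otimes> x \<otimes> inv h) \<otimes> inv g = (g \<otimes> h) \<otimes> x \<otimes> inv (g \<otimes> h)"
  using assms by (simp add: inv_mult_group m_assoc)

lemma (in group) conj_eq_iff:
  assumes "g \<in> carrier G" "x \<in> carrier G"
  shows "g \<otimes> x \<otimes> inv g = x \<longleftrightarrow> g \<otimes> x = x \<otimes> g"
  using assms by (metis inv_closed inv_solve_right m_closed)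

text \<open>An arbitrary conjugation-invariant set \<open>E\<close> covers both actions, the one on
  all tuples and the one on commuting tuples.\<close>

lemma (in group) group_action_simul_conj:
  assumes sub: "\<And>xs. xs \<in> E \<Longrightarrow> set xs \<subseteq> carrier G"
    and closed: "\<And>g xs. g \<in> carrier G \<Longrightarrow> xs \<in> E \<Longrightarrow> map (\<lambda>x. g \<otimes> x \<otimes> inv g) xs \<in> E"
  shows "group_action G E (simul_conj G E)"
proof -
  have app: "simul_conj G E g xs = map (\<lambda>x. g \<otimes> x \<otimes> inv g) xs" if "xs \<in> E" for g xs
    using that by (simp add: simul_conj_def)
  have mult: "simul_conj G E g (simul_conj G E h xs) = simul_conj G E (g \<otimes> h) xs"
    if "g \<in> carrier G" "h \<in> carrier G" "xs \<in> E" for g h xs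
    using that sub[OF that(3)] closed by (auto simp: app conj_conj)
  have one: "simul_conj G E \<one> xs = xs" if "xs \<in> E" for xs
    using sub[OF that] by (auto simp: app[OF that] subset_iff intro: map_idI)
  have Bij: "simul_conj G E g \<in> Bij E" if g: "g \<in> carrier G" for g
  proof -
    have E: "simul_conj G E h xs \<in> E" if "h \<in> carrier G" "xs \<in> E" for h xs
      using that closed by (simp add: app)
    have "bij_betw (simul_conj G E g) E E"
      using g E by (intro bij_betw_byWitness[where f' = "simul_conj G E (inv g)"])
        (auto simp: mult one simp del: inv_inv)
    then show ?thesis by (simp add: Bij_def simul_conj_def)
  qed
  have "simul_conj G E \<in> hom G (BijGroup E)"
  proof (rule homI)
    fix g h assume gh: "g \<in> carrier G" "h \<in> carrier G"
    have "simul_conj G E (g \<otimes> h) = compose E (simul_conj G E g) (simul_conj G E h)"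
    proof
      fix xs
      show "simul_conj G E (g \<otimes> h) xs = compose E (simul_conj G E g) (simul_conj G E h) xs"
      \<comment> \<open>Elements of \<open>BijGroup\<close> are extensional, so the two maps must
        also agree off \<open>E\<close>, where both are \<open>undefined\<close>.\<close>
      proof (cases "xs \<in> E")
        case True
        then show ?thesis using mult[OF gh True] by (simp add: compose_def)
      next
        case False
        then show ?thesis by (simp add: compose_def simul_conj_def)
      qed
    qed
    then show "simul_conj G E (g \<otimes> h) = simul_conj G E g \<otimes>\<^bsub>BijGroup E\<^esub> simul_conj G E h"
      using Bij gh by (simp add: BijGroup_def)
  qed (simp add: BijGroup_def Bij)
  then show ?thesis
    unfolding group_action_def group_hom_def group_hom_axioms_def
    using is_group group_BijGroup by blast
qed

lemma (in group) invariants_simul_conj: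
  assumes sub: "\<And>xs. xs \<in> E \<Longrightarrow> set xs \<subseteq> carrier G" and g: "g \<in> carrier G"
  shows "invariants E (simul_conj G E) g = {xs \<in> E. \<forall>x\<in>set xs. g \<otimes> x = x \<otimes> g}"
proof -
  have "simul_conj G E g xs = xs \<longleftrightarrow> (\<forall>x\<in>set xs. g \<otimes> x = x \<otimes> g)" if "xs \<in> E" for xs
  proof -
    have "simul_conj G E g xs = xs \<longleftrightarrow> (\<forall>x\<in>set xs. g \<otimes> x \<otimes> inv g = x)"
      using that by (auto simp: simul_conj_def list_eq_iff_nth_eq all_set_conv_all_nth)
    then show ?thesis using conj_eq_iff[OF g] sub[OF that] by blast
  qed
  then show ?thesis unfolding invariants_def by blast
qed

text \<open>A tuple is fixed by \<open>g\<close> when all its entries lie in the centralizer of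
  \<open>g\<close>, hence the \<open>n\<close>-th powers in Burnside's sum.\<close>

lemma (in group) alpha_mult_order:
  assumes fin: "finite (carrier G)"
  shows "alpha G n * order G =
    (\<Sum>g\<in>carrier G. card {x \<in> carrier G. g \<otimes> x = x \<otimes> g} ^ n)"
proof -
  interpret action: group_action G "tuples G n" "simul_conj G (tuples G n)"
    by (rule group_action_simul_conj) (auto simp: tuples_def)
  have "finite (tuples G n)"
    unfolding tuples_def using finite_lists_length_eq[OF fin, of n] by (simp add: conj_commute)
  then have "alpha G n * order G = (\<Sum>g\<in>carrier G. card (invariants (tuples G n) (simul_conj G (tuples G n)) g))"
    unfolding alpha_def by (rule action.burnside[OF fin])
  also have "\<dots> = (\<Sum>g\<in>carrier G. card {x \<in> carrier G. g \<otimes> x = x \<otimes> g} ^ n)"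
  proof (rule sum.cong[OF HOL.refl])
    fix g assume g: "g \<in> carrier G"
    have "invariants (tuples G n) (simul_conj G (tuples G n)) g =
        {xs. set xs \<subseteq> {x \<in> carrier G. g \<otimes> x = x \<otimes> g} \<and> length xs = n}"
      using invariants_simul_conj[OF _ g, of "tuples G n"] by (auto simp: tuples_def)
    then show "card (invariants (tuples G n) (simul_conj G (tuples G n)) g) =
        card {x \<in> carrier G. g \<otimes> x = x \<otimes> g} ^ n"
      using fin by (simp add: card_lists_length_eq)
  qed
  finally show ?thesis .
qed

lemma commuting_tuples_eq_related_lists:
  "commuting_tuples G n = related_lists (\<lambda>x y. x \<otimes>\<^bsub>G\<^esub> y = y \<otimes>\<^bsub>G\<^esub> x) (carrier G) n"
  by (auto simp: commuting_tuples_def related_lists_def tuples_def)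

text \<open>The head of a commuting tuple of length \<open>Suc n\<close> is a group element fixing
  the commuting tail, so these tuples enumerate the pairs that Burnside's sum counts.\<close>

lemma (in group) beta_mult_order:
  assumes fin: "finite (carrier G)"
  shows "beta G n * order G = card (commuting_tuples G (Suc n))"
proof -
  let ?E = "commuting_tuples G n"
  interpret action: group_action G ?E "simul_conj G ?E"
  proof (rule group_action_simul_conj)
    fix g xs assume g: "g \<in> carrier G" and xs: "xs \<in> ?E"
    have "(g \<otimes> x \<otimes> inv g) \<otimes> (g \<otimes> y \<otimes> inv g) = g \<otimes> (x \<otimes> y) \<otimes> inv g"
      if "x \<in> carrier G" "y \<in> carrier G" for x y
      using g that by (simp add: m_assoc[symmetric]) (simp add: m_assoc)
    then show "map (\<lambda>x. g \<otimes> x \<otimes> inv g) xs \<in> ?E"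
      using xs g unfolding commuting_tuples_def tuples_def by (auto simp: subset_iff)
  qed (auto simp: commuting_tuples_def tuples_def)
  have finE: "finite ?E" unfolding commuting_tuples_def tuples_def
    by (rule finite_subset[OF _ finite_lists_length_eq[OF fin, of n]]) auto
  have "commuting_tuples G (Suc n) =
      (\<lambda>(g, xs). g # xs) ` (SIGMA g:carrier G. invariants ?E (simul_conj G ?E) g)"
  proof -
    have inv: "invariants ?E (simul_conj G ?E) g = {xs \<in> ?E. \<forall>x\<in>set xs. g \<otimes> x = x \<otimes> g}"
      if "g \<in> carrier G" for g
      using that by (rule invariants_simul_conj[rotated]) (auto simp: commuting_tuples_def tuples_def)
    have "(SIGMA g:carrier G. invariants ?E (simul_conj G ?E) g) =
        (SIGMA g:carrier G. {xs \<in> ?E. \<forall>x\<in>set xs. g \<otimes> x = x \<otimes> g})"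
      by (rule Sigma_cong) (simp_all add: inv)
    moreover have "ys \<in> commuting_tuples G (Suc n) \<longleftrightarrow> ys \<in> (\<lambda>(g, xs). g # xs) `
        (SIGMA g:carrier G. {xs \<in> ?E. \<forall>x\<in>set xs. g \<otimes> x = x \<otimes> g})" for ys
      by (cases ys) (auto simp: commuting_tuples_def tuples_def)
    ultimately show ?thesis by blast
  qed
  moreover have "inj_on (\<lambda>(g, xs). g # xs) X" for X :: "('a \<times> 'a list) set"
    by (auto simp: inj_on_def)
  ultimately have "card (commuting_tuples G (Suc n)) =
      (\<Sum>g\<in>carrier G. card (invariants ?E (simul_conj G ?E) g))"
    using fin finE by (simp add: card_image invariants_def)
  then show ?thesis unfolding beta_def using action.burnside[OF fin finE] by simp
qed

section \<open>Centre, commutators and the transfer of commuting along an isoclinism\<close>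

lemma (in group) subgroup_group_center: "subgroup (group_center G) G"
proof
  fix x y assume xy: "x \<in> group_center G" "y \<in> group_center G"
  then have [simp]: "x \<in> carrier G" "y \<in> carrier G"
    and x: "\<And>z. z \<in> carrier G \<Longrightarrow> x \<otimes> z = z \<otimes> x" and y: "\<And>z. z \<in> carrier G \<Longrightarrow> y \<otimes> z = z \<otimes> y"
    by (auto simp: group_center_def)
  have "x \<otimes> y \<otimes> z = z \<otimes> (x \<otimes> y)" if z: "z \<in> carrier G" for z
  proof -
    have "x \<otimes> y \<otimes> z = x \<otimes> (z \<otimes> y)" using z y[OF z] by (simp add: m_assoc)
    also have "\<dots> = z \<otimes> x \<otimes> y" using z x[OF z] by (simp add: m_assoc[symmetric])
    finally show ?thesis using z by (simp add: m_assoc)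
  qed
  then show "x \<otimes> y \<in> group_center G" by (simp add: group_center_def)
next
  fix x assume "x \<in> group_center G"
  then have [simp]: "x \<in> carrier G" and x: "\<And>z. z \<in> carrier G \<Longrightarrow> x \<otimes> z = z \<otimes> x"
    by (auto simp: group_center_def)
  have "inv x \<otimes> z = z \<otimes> inv x" if z: "z \<in> carrier G" for z
  proof -
    have "inv x \<otimes> z = inv x \<otimes> (z \<otimes> x) \<otimes> inv x" using z by (simp add: m_assoc)
    also have "\<dots> = inv x \<otimes> (x \<otimes> z) \<otimes> inv x" using x[OF z] by simp
    also have "\<dots> = z \<otimes> inv x" using z by (simp add: m_assoc[symmetric])
    finally show ?thesis .
  qed
  then show "inv x \<in> group_center G" by (simp add: group_center_def)
qed (auto simp: group_center_def)

lemma (in group) commutator_eq_one_iff: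
  assumes "x \<in> carrier G" "y \<in> carrier G"
  shows "commutator G x y = \<one> \<longleftrightarrow> x \<otimes> y = y \<otimes> x"
proof -
  have "commutator G x y = inv (y \<otimes> x) \<otimes> (x \<otimes> y)"
    using assms by (simp add: commutator_def inv_mult_group m_assoc)
  moreover have "inv (y \<otimes> x) \<otimes> (x \<otimes> y) = \<one> \<longleftrightarrow> x \<otimes> y = y \<otimes> x \<otimes> \<one>"
    using assms by (intro inv_solve_left') simp_all
  ultimately show ?thesis using assms by simp
qed

text \<open>The generators of \<open>derived\<close> have the inverses on the right; the present
  commutator is such a generator for \<open>inv x\<close> and \<open>inv y\<close>.\<close>

lemma (in group) commutator_in_derived:
  assumes "x \<in> carrier G" "y \<in> carrier G"
  shows "commutator G x y \<in> derived G (carrier G)"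
proof -
  have "commutator G x y = inv x \<otimes> inv y \<otimes> inv (inv x) \<otimes> inv (inv y)"
    using assms by (simp add: commutator_def)
  then show ?thesis unfolding derived_def using assms
    by (intro generate.incl UN_I[of "inv x"] UN_I[of "inv y"]) simp_all
qed

lemma (in group) group_derived_group: "group (derived_group G)"
  unfolding derived_group_def
  by (rule subgroup_imp_group[OF derived_is_subgroup]) simp

text \<open>Commuting means having trivial commutator, and the isomorphism \<phi> sends only the
  identity to the identity. So \<theta> matches commuting pairs of centre cosets in \<open>G\<close>
  with commuting pairs in \<open>K\<close>, and a coordinate map \<open>k\<close> on
  \<open>K\<close> whose fibres are the centre cosets can be pulled back to
  \<open>G\<close>.\<close>

lemma isoclinic_centre_map:
  fixes G :: "('a, 'b) monoid_scheme" and K :: "('c, 'd) monoid_scheme"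
  assumes G: "group G" and K: "group K" and fin: "finite (carrier G)" and iso: "isoclinic G K"
    and surj: "k ` carrier K = V"
    and coset: "\<And>x y. x \<in> carrier K \<Longrightarrow> y \<in> carrier K \<Longrightarrow>
      k x = k y \<longleftrightarrow> group_center K #>\<^bsub>K\<^esub> x = group_center K #>\<^bsub>K\<^esub> y"
    and comm: "\<And>x y. x \<in> carrier K \<Longrightarrow> y \<in> carrier K \<Longrightarrow>
      x \<otimes>\<^bsub>K\<^esub> y = y \<otimes>\<^bsub>K\<^esub> x \<longleftrightarrow> R (k x) (k y)"
  obtains f where "f ` carrier G = V"
    and "\<And>v. v \<in> V \<Longrightarrow> card {x \<in> carrier G. f x = v} = card (group_center G)"
    and "\<And>x y. x \<in> carrier G \<Longrightarrow> y \<in> carrier G \<Longrightarrow>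
      x \<otimes>\<^bsub>G\<^esub> y = y \<otimes>\<^bsub>G\<^esub> x \<longleftrightarrow> R (f x) (f y)"
proof -
  interpret G: group G by (rule G)
  interpret K: group K by (rule K)
  let ?ZG = "group_center G" and ?ZK = "group_center K"
  obtain \<theta> \<phi> where \<theta>: "\<theta> \<in> iso (G Mod ?ZG) (K Mod ?ZK)"
    and \<phi>: "\<phi> \<in> iso (derived_group G) (derived_group K)"
    and compat: "\<And>g\<^sub>1 g\<^sub>2 h\<^sub>1 h\<^sub>2. \<lbrakk>g\<^sub>1 \<in> carrier G; g\<^sub>2 \<in> carrier G; h\<^sub>1 \<in> carrier K; h\<^sub>2 \<in> carrier K;
        \<theta> (?ZG #>\<^bsub>G\<^esub> g\<^sub>1) = ?ZK #>\<^bsub>K\<^esub> h\<^sub>1; \<theta> (?ZG #>\<^bsub>G\<^esub> g\<^sub>2) = ?ZK #>\<^bsub>K\<^esub> h\<^sub>2\<rbrakk> \<Longrightarrow>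
        \<phi> (commutator G g\<^sub>1 g\<^sub>2) = commutator K h\<^sub>1 h\<^sub>2"
    using iso unfolding isoclinic_def by blast
  have bij\<theta>: "bij_betw \<theta> ((\<lambda>x. ?ZG #>\<^bsub>G\<^esub> x) ` carrier G) ((\<lambda>x. ?ZK #>\<^bsub>K\<^esub> x) ` carrier K)"
    using \<theta> by (simp add: iso_def carrier_FactGroup)
  have \<phi>_one: "\<phi> \<one>\<^bsub>G\<^esub> = \<one>\<^bsub>K\<^esub>"
    using hom_one[of \<phi> "derived_group G" "derived_group K"] \<phi> G.group_derived_group K.group_derived_group
    by (simp add: iso_def derived_group_def)
  have \<phi>_eq_one: "\<phi> c = \<one>\<^bsub>K\<^esub> \<longleftrightarrow> c = \<one>\<^bsub>G\<^esub>" if "c \<in> derived G (carrier G)" for c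
  proof -
    have "inj_on \<phi> (derived G (carrier G))"
      using \<phi> by (simp add: iso_def bij_betw_def derived_group_def)
    moreover have "\<one>\<^bsub>G\<^esub> \<in> derived G (carrier G)"
      using G.derived_is_subgroup[of "carrier G"] subgroup.one_closed by blast
    ultimately show ?thesis using that \<phi>_one by (metis inj_onD)
  qed
  have "\<exists>y\<in>carrier K. \<theta> (?ZG #>\<^bsub>G\<^esub> x) = ?ZK #>\<^bsub>K\<^esub> y" if "x \<in> carrier G" for x
    using bij_betw_imp_surj_on[OF bij\<theta>] that by blast
  then obtain t where t: "\<And>x. x \<in> carrier G \<Longrightarrow> t x \<in> carrier K"
    and \<theta>t: "\<And>x. x \<in> carrier G \<Longrightarrow> \<theta> (?ZG #>\<^bsub>G\<^esub> x) = ?ZK #>\<^bsub>K\<^esub> t x"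
    by metis
  \<comment> \<open>\<open>t\<close> picks arbitrary coset representatives; the choice does not
    affect \<open>f\<close>, because \<open>k\<close> is constant on cosets of the centre.\<close>
  define f where "f = k \<circ> t"
  have f_eq: "f x = f y \<longleftrightarrow> ?ZG #>\<^bsub>G\<^esub> x = ?ZG #>\<^bsub>G\<^esub> y" if "x \<in> carrier G" "y \<in> carrier G" for x y
  proof -
    have "f x = f y \<longleftrightarrow> \<theta> (?ZG #>\<^bsub>G\<^esub> x) = \<theta> (?ZG #>\<^bsub>G\<^esub> y)"
      using that t by (simp add: f_def coset \<theta>t)
    then show ?thesis using that by (simp add: inj_on_eq_iff[OF bij_betw_imp_inj_on[OF bij\<theta>]])
  qed
  have f_surj: "f ` carrier G = V"
  proof
    show "f ` carrier G \<subseteq> V" using t surj by (auto simp: f_def)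
    show "V \<subseteq> f ` carrier G"
    proof
      fix v assume "v \<in> V"
      then obtain y where y: "y \<in> carrier K" "v = k y" using surj by blast
      obtain x where x: "x \<in> carrier G" "\<theta> (?ZG #>\<^bsub>G\<^esub> x) = ?ZK #>\<^bsub>K\<^esub> y"
        using bij_betw_imp_surj_on[OF bij\<theta>] y(1) by (metis (no_types, lifting) imageE image_eqI)
      then have "v = f x" using y t \<theta>t coset by (simp add: f_def)
      then show "v \<in> f ` carrier G" using x(1) by blast
    qed
  qed
  have "card {x \<in> carrier G. f x = v} = card ?ZG" if v: "v \<in> V" for v
  proof -
    obtain y where y: "y \<in> carrier G" "v = f y" using v unfolding f_surj[symmetric] by blast
    note Z = G.subgroup_group_center
    have sub: "?ZG #>\<^bsub>G\<^esub> y \<subseteq> carrier G"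
      using y(1) subgroup.subset[OF Z] by (simp add: G.r_coset_subset_G)
    have "{x \<in> carrier G. f x = v} = ?ZG #>\<^bsub>G\<^esub> y"
    proof (intro Set.set_eqI iffI)
      fix x assume "x \<in> {x \<in> carrier G. f x = v}"
      then have x: "x \<in> carrier G" "f x = f y" using y(2) by auto
      show "x \<in> ?ZG #>\<^bsub>G\<^esub> y" using G.rcos_self[OF x(1) Z] f_eq[OF x(1) y(1)] x(2) by simp
    next
      fix x assume x: "x \<in> ?ZG #>\<^bsub>G\<^esub> y"
      then have "x \<in> carrier G" using sub by blast
      moreover from this have "f x = f y"
        using f_eq[OF _ y(1)] G.repr_independence[OF x y(1) Z] by simp
      ultimately show "x \<in> {x \<in> carrier G. f x = v}" using y(2) by simp
    qed
    moreover have "?ZG #>\<^bsub>G\<^esub> y \<in> rcosets\<^bsub>G\<^esub> ?ZG" using y(1) by (auto simp: RCOSETS_def)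
    ultimately show ?thesis
      using G.card_rcosets_equal[OF _ subgroup.subset[OF Z]] by simp
  qed
  moreover have "x \<otimes>\<^bsub>G\<^esub> y = y \<otimes>\<^bsub>G\<^esub> x \<longleftrightarrow> R (f x) (f y)" if "x \<in> carrier G" "y \<in> carrier G" for x y
  proof -
    have "x \<otimes>\<^bsub>G\<^esub> y = y \<otimes>\<^bsub>G\<^esub> x \<longleftrightarrow> \<phi> (commutator G x y) = \<one>\<^bsub>K\<^esub>"
      using that by (simp add: \<phi>_eq_one G.commutator_in_derived G.commutator_eq_one_iff)
    also have "\<phi> (commutator G x y) = commutator K (t x) (t y)"
      using that t \<theta>t by (intro compat)
    finally show ?thesis using that t by (simp add: K.commutator_eq_one_iff comm f_def)
  qed
  ultimately show ?thesis using that f_surj by blast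
qed

text \<open>Every group element in a counted configuration contributes one factor \<open>z\<close>,
  the fibre size. There are \<open>Suc n\<close> of them: the \<open>n\<close> entries of the tuple
  and the acting element.\<close>

lemma (in group) counts_of_centre_map:
  assumes fin: "finite (carrier G)" and surj: "f ` carrier G = V"
    and fibre: "\<And>v. v \<in> V \<Longrightarrow> card {x \<in> carrier G. f x = v} = z"
    and comm: "\<And>x y. x \<in> carrier G \<Longrightarrow> y \<in> carrier G \<Longrightarrow> x \<otimes> y = y \<otimes> x \<longleftrightarrow> R (f x) (f y)"
  shows "order G = z * card V"
    and "alpha G n * order G = z ^ Suc n * (\<Sum>v\<in>V. card {w \<in> V. R v w} ^ n)"
    and "beta G n * order G = z ^ Suc n * card (related_lists R V (Suc n))"
proof -
  have finV: "finite V" using fin surj by blast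
  note fib = fin finV equalityD1[OF surj] fibre
  show "order G = z * card V"
    using card_vimage_fibres[OF fib, of "\<lambda>_. True"] by (simp add: order_def)
  have "card {y \<in> carrier G. x \<otimes> y = y \<otimes> x} = z * card {w \<in> V. R (f x) w}"
    if "x \<in> carrier G" for x
  proof -
    have "{y \<in> carrier G. x \<otimes> y = y \<otimes> x} = {y \<in> carrier G. R (f x) (f y)}"
      using comm[OF that] by blast
    then show ?thesis using card_vimage_fibres[OF fib, of "R (f x)"] by simp
  qed
  then have "alpha G n * order G = (\<Sum>x\<in>carrier G. (z * card {w \<in> V. R (f x) w}) ^ n)"
    using alpha_mult_order[OF fin, of n] by simp
  also have "\<dots> = z * (\<Sum>v\<in>V. (z * card {w \<in> V. R v w}) ^ n)"
    by (rule sum_fibres[OF fib])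
  also have "\<dots> = z ^ Suc n * (\<Sum>v\<in>V. card {w \<in> V. R v w} ^ n)"
    by (simp add: power_mult_distrib sum_distrib_left mult.assoc)
  finally show "alpha G n * order G = z ^ Suc n * (\<Sum>v\<in>V. card {w \<in> V. R v w} ^ n)" .
  have "commuting_tuples G (Suc n) = {xs. set xs \<subseteq> carrier G \<and> length xs = Suc n \<and>
      (\<forall>x\<in>set (map f xs). \<forall>y\<in>set (map f xs). R x y)}"
  proof -
    have "(\<forall>x\<in>set xs. \<forall>y\<in>set xs. x \<otimes> y = y \<otimes> x) \<longleftrightarrow> (\<forall>x\<in>set xs. \<forall>y\<in>set xs. R (f x) (f y))"
      if "set xs \<subseteq> carrier G" for xs
      using that by (intro ball_cong HOL.refl comm) auto
    then show ?thesis unfolding commuting_tuples_eq_related_lists related_lists_def by auto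
  qed
  then have "card (commuting_tuples G (Suc n)) = z ^ Suc n * card (related_lists R V (Suc n))"
    using card_lists_vimage[OF fib, of "Suc n" "\<lambda>vs. \<forall>x\<in>set vs. \<forall>y\<in>set vs. R x y"]
    by (simp add: related_lists_def)
  then show "beta G n * order G = z ^ Suc n * card (related_lists R V (Suc n))"
    using beta_mult_order[OF fin] by simp
qed

section \<open>Metacyclic groups\<close>

definition geom_sum :: "nat \<Rightarrow> nat \<Rightarrow> nat" where
  "geom_sum p n = (\<Sum>k<n. (1 + p) ^ k)"

lemma power_eq_geom_sum: "(1 + p) ^ n = 1 + p * geom_sum p n"
  by (induction n) (simp_all add: geom_sum_def algebra_simps)

lemma geom_sum_add: "geom_sum p (m + n) = geom_sum p m + (1 + p) ^ m * geom_sum p n"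
  by (induction n) (simp_all add: geom_sum_def algebra_simps power_add)

lemma geom_sum_0 [simp]: "geom_sum p 0 = 0" and geom_sum_1 [simp]: "geom_sum p (Suc 0) = 1"
  by (simp_all add: geom_sum_def)

lemma cong_mult_cancel_nat:
  fixes c :: nat
  assumes "c > 0"
  shows "[c * a = c * b] (mod c * m) \<longleftrightarrow> [a = b] (mod m)"
  using assms by (simp add: cong_def mult_mod_right[symmetric])

text \<open>The binomial expansion gives n + p n(n-1)/2 modulo p^2. Doubling removes the fraction,
  and moving p n to the left removes the subtraction.\<close>

lemma geom_sum_cong_quadratic:
  "[2 * geom_sum p n + p * n = 2 * n + p * n * n] (mod p ^ 2)"
proof (induction n)
  case (Suc n)
  have pow: "[(1 + p) ^ n = 1 + p * n] (mod p ^ 2)" for n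
  proof (induction n)
    case (Suc n)
    have "[(1 + p) ^ Suc n = (1 + p) * (1 + p * n)] (mod p ^ 2)"
      using cong_scalar_left[OF Suc.IH, of "1 + p"] by simp
    also have "(1 + p) * (1 + p * n) = 1 + p * Suc n + p ^ 2 * n"
      by (simp add: algebra_simps power2_eq_square)
    also have "[\<dots> = 1 + p * Suc n] (mod p ^ 2)" by (simp add: cong_def)
    finally show ?case .
  qed simp
  have "2 * geom_sum p (Suc n) + p * Suc n = (2 * geom_sum p n + p * n) + (2 * (1 + p) ^ n + p)"
    by (simp add: geom_sum_def)
  also have "[\<dots> = (2 * n + p * n * n) + (2 * (1 + p * n) + p)] (mod p ^ 2)"
    by (intro cong_add Suc.IH cong_scalar_left pow cong_refl)
  also have "(2 * n + p * n * n) + (2 * (1 + p * n) + p) = 2 * Suc n + p * Suc n * Suc n"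
    by (simp add: algebra_simps)
  finally show ?case .
qed simp

text \<open>When p divides n, the quadratic correction vanishes modulo p^2; oddness of p allows the
  factor 2 to be cancelled.\<close>

lemma geom_sum_cong_id:
  assumes "odd p" and "p dvd n"
  shows "[geom_sum p n = n] (mod p ^ 2)"
proof -
  have pn: "[p * n = 0] (mod p ^ 2)"
    using assms(2) by (auto simp: cong_0_iff power2_eq_square)
  have "[2 * geom_sum p n + 0 = 2 * geom_sum p n + p * n] (mod p ^ 2)"
    by (intro cong_add cong_refl cong_sym[OF pn])
  also note geom_sum_cong_quadratic[of p n]
  also have "[2 * n + p * n * n = 2 * n + 0] (mod p ^ 2)"
    using cong_scalar_right[OF pn, of n] by (intro cong_add cong_refl) simp
  finally show ?thesis
    using assms(1) by (simp add: cong_mult_lcancel_nat)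
qed

text \<open>Modulo p the sum is congruent to n, so either side forces p to divide n; then the
  congruence of the sum with n holds modulo p^2 as well.\<close>

lemma dvd_geom_sum_iff:
  assumes "odd p"
  shows "p ^ 2 dvd geom_sum p n \<longleftrightarrow> p ^ 2 dvd n"
proof -
  have "[geom_sum p n = n] (mod p)"
  proof -
    have "[2 * geom_sum p n + p * n = 2 * n + p * n * n] (mod p)"
      by (rule cong_dvd_modulus_nat[OF geom_sum_cong_quadratic]) simp
    then have "[2 * geom_sum p n = 2 * n] (mod p)"
      by (simp add: cong_def mult.assoc)
    then show ?thesis using assms by (simp add: cong_mult_lcancel_nat)
  qed
  then have "p dvd geom_sum p n \<longleftrightarrow> p dvd n" by (rule cong_dvd_iff)
  moreover have "p dvd p ^ 2" by simp
  ultimately have "p dvd n" if "p ^ 2 dvd geom_sum p n \<or> p ^ 2 dvd n"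
    using that dvd_trans by blast
  then show ?thesis using geom_sum_cong_id[OF assms] cong_dvd_iff by blast
qed

text \<open>By \<open>geom_sum_add\<close>, a difference of two sums is the unit (1+p)^m times
  another sum, which reduces the claim to divisibility by p^2.\<close>

lemma geom_sum_cong_iff:
  assumes "odd p"
  shows "[geom_sum p m = geom_sum p n] (mod p ^ 2) \<longleftrightarrow> [m = n] (mod p ^ 2)"
proof -
  have *: "[geom_sum p (m + d) = geom_sum p m] (mod p ^ 2) \<longleftrightarrow> [m + d = m] (mod p ^ 2)" for m d
  proof -
    have "coprime ((1 + p) ^ m) (p ^ 2)" by simp
    then have "p ^ 2 dvd (1 + p) ^ m * geom_sum p d \<longleftrightarrow> p ^ 2 dvd d"
      by (simp add: coprime_dvd_mult_right_iff coprime_commute dvd_geom_sum_iff[OF assms])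
    then show ?thesis by (simp add: geom_sum_add cong_add_lcancel_0_nat cong_0_iff)
  qed
  show ?thesis
  proof (cases "m \<le> n")
    case True
    then show ?thesis using *[of m "n - m"] by (auto simp: cong_sym_eq)
  next
    case False
    then show ?thesis using *[of n "m - n"] by simp
  qed
qed

text \<open>This is what makes the relations of the presentation compatible: conjugation by alpha_2
  multiplies exponents of alpha_1 by 1 + p, and p^2 such conjugations have to be trivial on
  exponents modulo p^3.\<close>

lemma power_cong_one:
  assumes "odd p"
  shows "[(1 + p) ^ (p ^ 2) = 1] (mod p ^ 3)"
proof -
  have "p ^ 2 dvd geom_sum p (p ^ 2)" using dvd_geom_sum_iff[OF assms] by simp
  then have "p ^ 3 dvd p * geom_sum p (p ^ 2)" by (auto simp: power3_eq_cube power2_eq_square)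
  then show ?thesis unfolding power_eq_geom_sum by (simp add: cong_add_lcancel_0_nat cong_0_iff del: One_nat_def)
qed

lemma geom_sum_surj:
  assumes "odd p" and "v < p ^ 2"
  shows "\<exists>j. geom_sum p j mod p ^ 2 = v"
proof -
  have "inj_on (\<lambda>j. geom_sum p j mod p ^ 2) {..<p ^ 2}"
    using geom_sum_cong_iff[OF assms(1)] by (auto simp: inj_on_def cong_def)
  moreover have "(\<lambda>j. geom_sum p j mod p ^ 2) ` {..<p ^ 2} \<subseteq> {..<p ^ 2}"
    using odd_pos[OF assms(1)] by auto
  ultimately have "(\<lambda>j. geom_sum p j mod p ^ 2) ` {..<p ^ 2} = {..<p ^ 2}"
    by (intro endo_inj_surj) auto
  then have "v \<in> (\<lambda>j. geom_sum p j mod p ^ 2) ` {..<p ^ 2}" using assms(2) by simp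
  then show ?thesis by blast
qed

text \<open>\<open>x\<close> and \<open>y\<close> play the roles of alpha_1 and alpha_2, and
  \<open>swap\<close> expresses [x, y] = x^p. The relations are separated from the normal form
  axioms because the existence of normal forms in the presented group is itself derived from
  \<open>normal_form_mult\<close>.\<close>

locale metacyclic_relations = group +
  fixes p :: nat and x y
  assumes x_closed [simp]: "x \<in> carrier G" and y_closed [simp]: "y \<in> carrier G"
    and swap: "x \<otimes> y = y \<otimes> x [^] (1 + p)"
    and x_power: "x [^] (p ^ 3) = \<one>" and y_power: "y [^] (p ^ 2) = \<one>"
begin

lemma swap_powers: "x [^] i \<otimes> y [^] j = y [^] j \<otimes> x [^] (i * (1 + p) ^ j)" for i j :: nat
proof (induction j)
  case (Suc j)
  have 1: "x [^] i \<otimes> y = y \<otimes> x [^] (i * (1 + p))" for i :: nat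
  proof (induction i)
    case (Suc i)
    have "x [^] Suc i \<otimes> y = x [^] i \<otimes> y \<otimes> x [^] (1 + p)"
      using swap by (simp add: m_assoc del: One_nat_def)
    also have "\<dots> = y \<otimes> x [^] (Suc i * (1 + p))"
      unfolding Suc.IH by (simp only: m_assoc nat_pow_closed x_closed y_closed nat_pow_mult mult_Suc add.commute)
    finally show ?case .
  qed simp
  have "x [^] i \<otimes> y [^] Suc j = y [^] j \<otimes> (x [^] (i * (1 + p) ^ j) \<otimes> y)"
    using Suc.IH by (simp add: m_assoc[symmetric])
  also have "\<dots> = y [^] Suc j \<otimes> x [^] (i * (1 + p) ^ Suc j)"
    unfolding 1 by (simp add: m_assoc mult.commute mult.left_commute)
  finally show ?case .
qed simp

lemma normal_form_mult:
  "(y [^] j \<otimes> x [^] i) \<otimes> (y [^] l \<otimes> x [^] k) = y [^] (j + l) \<otimes> x [^] (i * (1 + p) ^ l + k)"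
  for i j k l :: nat
proof -
  have "(y [^] j \<otimes> x [^] i) \<otimes> (y [^] l \<otimes> x [^] k) = y [^] j \<otimes> (x [^] i \<otimes> y [^] l) \<otimes> x [^] k"
    by (simp add: m_assoc)
  then show ?thesis unfolding swap_powers by (simp add: m_assoc nat_pow_mult[symmetric])
qed

lemma pow_cong:
  fixes m n k :: nat
  assumes "z \<in> carrier G" and "z [^] k = \<one>" and "[m = n] (mod k)"
  shows "z [^] m = z [^] n"
proof -
  have "z [^] n = z [^] (n mod k)" for n
  proof -
    have "z [^] n = z [^] (k * (n div k) + n mod k)" by simp
    also have "\<dots> = (z [^] k) [^] (n div k) \<otimes> z [^] (n mod k)"
      using assms(1) by (simp only: nat_pow_mult[symmetric] nat_pow_pow)
    finally show ?thesis using assms by simp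
  qed
  then show ?thesis using assms(3) by (metis cong_def)
qed

lemma normal_form_cong:
  assumes "[j = l] (mod p ^ 2)" and "[i = k] (mod p ^ 3)"
  shows "y [^] j \<otimes> x [^] i = y [^] l \<otimes> x [^] k"
  using pow_cong[OF y_closed y_power assms(1)] pow_cong[OF x_closed x_power assms(2)] by simp

end

text \<open>Uniqueness says that no further collapse takes place; together with existence it fixes
  the order as p^5. Exponents are arbitrary naturals, compared modulo the orders of \<open>y\<close>
  and \<open>x\<close>.\<close>

locale metacyclic = metacyclic_relations +
  assumes odd_p: "odd p"
    and normal_form: "g \<in> carrier G \<Longrightarrow> \<exists>(j :: nat) (i :: nat). g = y [^] j \<otimes> x [^] i"
    and normal_form_unique: "\<And>(i :: nat) (j :: nat) (k :: nat) (l :: nat). y [^] j \<otimes> x [^] i = y [^] l \<otimes> x [^] k \<Longrightarrow>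
      [j = l] (mod p ^ 2) \<and> [i = k] (mod p ^ 3)"
begin

lemma p_pos: "p > 0" using odd_p by (cases p) auto

lemma normal_form_eq_iff:
  "y [^] j \<otimes> x [^] i = y [^] l \<otimes> x [^] k \<longleftrightarrow> [j = l] (mod p ^ 2) \<and> [i = k] (mod p ^ 3)"
  for i j k l :: nat
  using normal_form_cong normal_form_unique by blast

text \<open>Both products have \<open>y\<close>-exponent j + l, so only the
  \<open>x\<close>-exponents matter; there the common part i + k cancels, and the common factor p
  lowers the modulus from p^3 to p^2.\<close>

lemma commute_iff:
  "(y [^] j \<otimes> x [^] i) \<otimes> (y [^] l \<otimes> x [^] k) = (y [^] l \<otimes> x [^] k) \<otimes> (y [^] j \<otimes> x [^] i) \<longleftrightarrow>
    [i * geom_sum p l = geom_sum p j * k] (mod p ^ 2)"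
  for i j k l :: nat
proof -
  have expand: "i * (1 + p) ^ l + k = (i + k) + p * (i * geom_sum p l)"
    "k * (1 + p) ^ j + i = (i + k) + p * (geom_sum p j * k)"
    unfolding power_eq_geom_sum by (simp_all add: algebra_simps)
  have "(y [^] j \<otimes> x [^] i) \<otimes> (y [^] l \<otimes> x [^] k) = (y [^] l \<otimes> x [^] k) \<otimes> (y [^] j \<otimes> x [^] i) \<longleftrightarrow>
      [i * (1 + p) ^ l + k = k * (1 + p) ^ j + i] (mod p ^ 3)"
    unfolding normal_form_mult normal_form_eq_iff add.commute[of l j] by (simp only: cong_refl simp_thms)
  also have "\<dots> \<longleftrightarrow> [(i + k) + p * (i * geom_sum p l) = (i + k) + p * (geom_sum p j * k)] (mod p * p ^ 2)"
    unfolding expand by (simp only: power3_eq_cube power2_eq_square mult.assoc)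
  also have "\<dots> \<longleftrightarrow> [i * geom_sum p l = geom_sum p j * k] (mod p ^ 2)"
    unfolding cong_add_lcancel_nat by (rule cong_mult_cancel_nat[OF p_pos])
  finally show ?thesis .
qed

text \<open>The second coordinate is $((1+p)^j - 1)/p$ instead of $j$, which turns commuting into the
  vanishing of a determinant modulo $p^2$.\<close>

definition coords :: "'a \<Rightarrow> nat \<times> nat" where
  "coords g = (SOME v. \<exists>(j :: nat) (i :: nat). g = y [^] j \<otimes> x [^] i \<and> v = (i mod p ^ 2, geom_sum p j mod p ^ 2))"

text \<open>The choice of exponents is immaterial: they are unique modulo p^2 and p^3, and
  \<open>geom_sum\<close> respects congruence modulo p^2.\<close>

lemma coords_eq: "coords (y [^] j \<otimes> x [^] i) = (i mod p ^ 2, geom_sum p j mod p ^ 2)" for i j :: nat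
  unfolding coords_def
proof (rule some_equality)
  fix v assume "\<exists>(l :: nat) (k :: nat). y [^] j \<otimes> x [^] i = y [^] l \<otimes> x [^] k \<and> v = (k mod p ^ 2, geom_sum p l mod p ^ 2)"
  then obtain l k :: nat where eq: "y [^] j \<otimes> x [^] i = y [^] l \<otimes> x [^] k"
    and v: "v = (k mod p ^ 2, geom_sum p l mod p ^ 2)" by blast
  have "[geom_sum p j = geom_sum p l] (mod p ^ 2)" "[i = k] (mod p ^ 2)"
    using normal_form_unique[OF eq] geom_sum_cong_iff[OF odd_p]
    by (auto elim: cong_dvd_modulus_nat simp: le_imp_power_dvd)
  then show "v = (i mod p ^ 2, geom_sum p j mod p ^ 2)" by (simp add: v cong_def)
qed blast

lemma coords_surj: "coords ` carrier G = residue_pairs p"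
proof
  show "coords ` carrier G \<subseteq> residue_pairs p"
  proof
    fix v assume "v \<in> coords ` carrier G"
    then obtain j i :: nat where "v = coords (y [^] j \<otimes> x [^] i)" using normal_form by blast
    then show "v \<in> residue_pairs p" using p_pos by (simp add: coords_eq residue_pairs_def)
  qed
  show "residue_pairs p \<subseteq> coords ` carrier G"
  proof
    fix v assume v: "v \<in> residue_pairs p"
    then have "snd v < p ^ 2" by (auto simp: residue_pairs_def)
    then obtain j where "geom_sum p j mod p ^ 2 = snd v" using geom_sum_surj[OF odd_p] by blast
    then have "v = coords (y [^] j \<otimes> x [^] fst v)"
      using v by (auto simp: coords_eq residue_pairs_def)
    then show "v \<in> coords ` carrier G" by simp
  qed
qed

lemma commute_iff_coords:
  assumes "g \<in> carrier G" and "h \<in> carrier G"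
  shows "g \<otimes> h = h \<otimes> g \<longleftrightarrow> det_cong p (coords g) (coords h)"
proof -
  obtain j i l k :: nat where g: "g = y [^] j \<otimes> x [^] i" and h: "h = y [^] l \<otimes> x [^] k"
    using normal_form assms by metis
  show ?thesis unfolding g h commute_iff det_cong_def coords_eq
    by (simp add: cong_def mod_mult_eq)
qed

lemma center_iff:
  "y [^] j \<otimes> x [^] i \<in> group_center G \<longleftrightarrow> p ^ 2 dvd j \<and> p ^ 2 dvd i" for i j :: nat
proof
  assume c: "y [^] j \<otimes> x [^] i \<in> group_center G"
  have "(y [^] j \<otimes> x [^] i) \<otimes> (y [^] l \<otimes> x [^] k) = (y [^] l \<otimes> x [^] k) \<otimes> (y [^] j \<otimes> x [^] i)" for l k :: nat
    using c by (simp add: group_center_def)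
  then have *: "[i * geom_sum p l = geom_sum p j * k] (mod p ^ 2)" for l k
    unfolding commute_iff .
  \<comment> \<open>Commuting with \<open>x\<close> (l = 0, k = 1) gives the condition on j,
    commuting with \<open>y\<close> (l = 1, k = 0) the one on i.\<close>
  from *[of 0 1] *[of 1 0] have "p ^ 2 dvd geom_sum p j" "p ^ 2 dvd i"
    by (simp_all add: cong_0_iff cong_sym_eq[of 0])
  then show "p ^ 2 dvd j \<and> p ^ 2 dvd i" using dvd_geom_sum_iff[OF odd_p] by simp
next
  assume "p ^ 2 dvd j \<and> p ^ 2 dvd i"
  then have d: "p ^ 2 dvd geom_sum p j" "p ^ 2 dvd i" using dvd_geom_sum_iff[OF odd_p] by simp_all
  have "(y [^] j \<otimes> x [^] i) \<otimes> g = g \<otimes> (y [^] j \<otimes> x [^] i)" if "g \<in> carrier G" for g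
  proof -
    obtain l k :: nat where g: "g = y [^] l \<otimes> x [^] k" using normal_form[OF \<open>g \<in> carrier G\<close>] by blast
    have "[i * geom_sum p l = 0] (mod p ^ 2)" "[geom_sum p j * k = 0] (mod p ^ 2)"
      using d by (simp_all add: cong_0_iff)
    then show ?thesis unfolding g commute_iff by (meson cong_sym cong_trans)
  qed
  then show "y [^] j \<otimes> x [^] i \<in> group_center G" by (simp add: group_center_def)
qed

lemma center_mult:
  "z \<in> group_center G \<longleftrightarrow> (\<exists>q. z = x [^] (p ^ 2 * q))"
proof
  assume z: "z \<in> group_center G"
  then have "z \<in> carrier G" by (simp add: group_center_def)
  then obtain j i :: nat where z': "z = y [^] j \<otimes> x [^] i" using normal_form by blast
  with z have "p ^ 2 dvd j" and i: "p ^ 2 dvd i" by (auto simp: center_iff)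
  then have "z = y [^] (0::nat) \<otimes> x [^] i"
    unfolding z' by (intro normal_form_cong) (auto simp: cong_0_iff)
  then show "\<exists>q. z = x [^] (p ^ 2 * q)" using i by auto
next
  assume "\<exists>q. z = x [^] (p ^ 2 * q)"
  then obtain q where "z = y [^] (0::nat) \<otimes> x [^] (p ^ 2 * q)" by auto
  then show "z \<in> group_center G" using center_iff[of 0 "p ^ 2 * q"] by simp
qed

lemma center_coset_iff:
  assumes g: "g \<in> carrier G" and h: "h \<in> carrier G"
  shows "coords g = coords h \<longleftrightarrow> group_center G #> g = group_center G #> h"
proof
  let ?Z = "group_center G"
  note sub = subgroup_group_center
  \<comment> \<open>Adding a multiple of p^2 to the \<open>x\<close>-exponent amounts to multiplying
    by a central power of \<open>x\<close>, which stays in the coset.\<close>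
  have *: "?Z #> (y [^] j \<otimes> x [^] i) = ?Z #> (y [^] l \<otimes> x [^] (i + p ^ 2 * q))"
    if jl: "[j = l] (mod p ^ 2)" for i j l q :: nat
  proof -
    let ?z = "x [^] (p ^ 2 * q)"
    have z: "?z \<in> ?Z" using center_mult by blast
    then have "?z \<otimes> (y [^] j \<otimes> x [^] i) = (y [^] j \<otimes> x [^] i) \<otimes> ?z"
      by (simp add: group_center_def)
    also have "\<dots> = y [^] j \<otimes> x [^] (i + p ^ 2 * q)" by (simp add: m_assoc nat_pow_mult)
    also have "\<dots> = y [^] l \<otimes> x [^] (i + p ^ 2 * q)" by (rule normal_form_cong[OF jl cong_refl])
    finally have "y [^] l \<otimes> x [^] (i + p ^ 2 * q) \<in> ?Z #> (y [^] j \<otimes> x [^] i)"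
      using z unfolding r_coset_def by force
    then show ?thesis by (rule repr_independence[OF _ _ sub]) simp
  qed
  obtain j i l k :: nat where g': "g = y [^] j \<otimes> x [^] i" and h': "h = y [^] l \<otimes> x [^] k"
    using normal_form g h by metis
  {
    assume "coords g = coords h"
    then have jl: "[j = l] (mod p ^ 2)" and ik: "[i = k] (mod p ^ 2)"
      using geom_sum_cong_iff[OF odd_p, of j l] by (auto simp: g' h' coords_eq cong_def)
    show "?Z #> g = ?Z #> h"
    proof (cases "i \<le> k")
      case True
      then obtain q where "k = i + p ^ 2 * q" using ik
        by (metis add.commute cong_le_nat cong_sym mult.commute)
      then show ?thesis using *[OF jl] by (simp add: g' h')
    next
      case False
      then obtain q where "i = k + p ^ 2 * q" using ik
        by (metis add.commute cong_le_nat mult.commute nat_le_linear)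
      then show ?thesis using *[OF cong_sym[OF jl]] by (simp add: g' h')
    qed
  }
  {
    assume "?Z #> g = ?Z #> h"
    then have "h \<in> ?Z #> g" using rcos_self[OF h sub] by simp
    then obtain z where z: "z \<in> ?Z" "h = z \<otimes> g" unfolding r_coset_def by blast
    then obtain q where q: "z = x [^] (p ^ 2 * q)" using center_mult by blast
    have "h = g \<otimes> z" using z g by (simp add: group_center_def)
    also have "\<dots> = y [^] j \<otimes> x [^] (i + p ^ 2 * q)" by (simp add: g' q m_assoc nat_pow_mult)
    finally show "coords g = coords h" by (simp add: g' coords_eq)
  }
qed

end

section \<open>The presentation of $\Phi_8(32)$\<close>

text \<open>The letters act by right multiplication on the pairs \<open>(j, i)\<close> that encode
  $\alpha_2^j \alpha_1^i$, where $\alpha_1 \alpha_2 = \alpha_2 \alpha_1^{1+p}$. Exponents are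
  natural numbers, so inverse letters add $p^2 - 1$ or $p^3 - 1$. The action separates the normal
  forms, which shows that the presented group does not collapse.\<close>

fun phi8_act :: "nat \<Rightarrow> Phi8_gen \<times> bool \<Rightarrow> nat \<times> nat \<Rightarrow> nat \<times> nat" where
  "phi8_act p (Alpha1, True) (j, i) = (j, i + 1)"
| "phi8_act p (Alpha1, False) (j, i) = (j, i + (p ^ 3 - 1))"
| "phi8_act p (Alpha2, True) (j, i) = (j + 1, i * (1 + p))"
| "phi8_act p (Alpha2, False) (j, i) = (j + (p ^ 2 - 1), i * (1 + p) ^ (p ^ 2 - 1))"
| "phi8_act p (Beta, True) (j, i) = (j, i + p)"
| "phi8_act p (Beta, False) (j, i) = (j, i + (p ^ 3 - 1) * p)"

text \<open>\<open>phi8_act\<close> never reduces exponents, so its states stand for group elements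
  only up to this congruence.\<close>

definition exp_cong :: "nat \<Rightarrow> nat \<times> nat \<Rightarrow> nat \<times> nat \<Rightarrow> bool" where
  "exp_cong p s t \<longleftrightarrow> [fst s = fst t] (mod p ^ 2) \<and> [snd s = snd t] (mod p ^ 3)"

lemma exp_cong_refl: "exp_cong p s s" by (simp add: exp_cong_def)
lemma exp_cong_sym: "exp_cong p s t \<Longrightarrow> exp_cong p t s" by (auto simp: exp_cong_def cong_sym)
lemma exp_cong_trans: "exp_cong p s t \<Longrightarrow> exp_cong p t u \<Longrightarrow> exp_cong p s u"
  by (auto simp: exp_cong_def intro: cong_trans)

lemma phi8_act_cong:
  assumes "exp_cong p s t"
  shows "exp_cong p (phi8_act p a s) (phi8_act p a t)"
proof -
  obtain j i l k where st: "s = (j, i)" "t = (l, k)" by (cases s; cases t)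
  obtain g b where a: "a = (g, b)" by (cases a)
  show ?thesis using assms unfolding st a
    by (cases g; cases b) (simp_all only: exp_cong_def phi8_act.simps fst_conv snd_conv
        cong_add_rcancel_nat cong_scalar_right simp_thms)
qed

lemma fold_phi8_act_cong:
  "exp_cong p s t \<Longrightarrow> exp_cong p (fold (phi8_act p) w s) (fold (phi8_act p) w t)"
proof (induction w arbitrary: s t)
  case (Cons a w)
  then show ?case using Cons.IH[OF phi8_act_cong[OF Cons.prems]] by simp
qed simp

lemma fold_phi8_act_replicate:
  "fold (phi8_act p) (replicate n (Alpha1, True)) (j, i) = (j, i + n)"
  "fold (phi8_act p) (replicate n (Alpha2, True)) (j, i) = (j + n, i * (1 + p) ^ n)"
  "fold (phi8_act p) (replicate n (Beta, True)) (j, i) = (j, i + n * p)"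
  by (induction n arbitrary: j i) (simp_all add: algebra_simps)

lemma phi8_act_cancel:
  assumes "odd p"
  shows "exp_cong p (phi8_act p (g, \<not> b) (phi8_act p (g, b) s)) s"
proof -
  obtain j i where s: "s = (j, i)" by (cases s)
  have pos: "p ^ 3 > 0" "p ^ 2 > 0" using odd_pos[OF assms] by simp_all
  \<comment> \<open>An \<open>Alpha2\<close> letter and its inverse together multiply i by
    (1+p)^(p^2).\<close>
  have r: "[i * ((1 + p) * (1 + p) ^ (p ^ 2 - 1)) = i] (mod p ^ 3)"
    using cong_scalar_left[OF power_cong_one[OF assms], of i] pos
    by (simp add: power_eq_if)
  have "1 + (p ^ 3 - 1) = p ^ 3" "1 + (p ^ 2 - 1) = p ^ 2" "p + (p ^ 3 - 1) * p = p ^ 3 * p"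
    using pos by (simp_all add: diff_mult_distrib)
  then have "[i + (1 + (p ^ 3 - 1)) = i] (mod p ^ 3)" "[j + (1 + (p ^ 2 - 1)) = j] (mod p ^ 2)"
    "[i + (p + (p ^ 3 - 1) * p) = i] (mod p ^ 3)"
    by (simp_all add: cong_add_lcancel_0_nat cong_0_iff)
  then show ?thesis using r unfolding s
    by (cases g; cases b) (simp_all only: exp_cong_def phi8_act.simps fst_conv snd_conv
      cong_refl simp_thms ac_simps not_True_eq_False not_False_eq_True)
qed

lemma phi8_act_relation:
  assumes "odd p" and "(u, v) \<in> Phi8_relations p"
  shows "exp_cong p (fold (phi8_act p) u s) (fold (phi8_act p) v s)"
proof -
  obtain j i where s: "s = (j, i)" by (cases s)
  have pos: "p ^ 3 > 0" "p ^ 2 > 0" using odd_pos[OF assms(1)] by simp_all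
  let ?F = "fold (phi8_act p)"
  consider "u = word_commutator Alpha1 Alpha2" "v = word_pow Beta 1"
    | "u = word_pow Beta 1" "v = word_pow Alpha1 p"
    | "u = word_pow Beta (p ^ 2)" "v = []" | "u = word_pow Alpha2 (p ^ 2)" "v = []"
    using assms(2) unfolding Phi8_relations_def by auto
  then show ?thesis
  proof cases
    case 1
    \<comment> \<open>\<open>r'\<close> inverts 1 + p modulo p^3 and \<open>i'\<close> stands for i
      - 1, so the commutator sends i to ((i - 1) r' + 1)(1 + p) = i + p.\<close>
    define r' where "r' = (1 + p) ^ (p ^ 2 - 1)"
    define i' where "i' = i + (p ^ 3 - 1)"
    have "r' * (1 + p) = (1 + p) ^ (p ^ 2)"
      unfolding r'_def using pos(2) by (simp add: power_eq_if)
    then have r': "[r' * (1 + p) = 1] (mod p ^ 3)" using power_cong_one[OF assms(1)] by simp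
    have "?F u s = (j + (p ^ 2 - 1) + 1, (i' * r' + 1) * (1 + p))"
      unfolding 1 s word_commutator_def i'_def r'_def by simp
    moreover have "?F v s = (j, i + p)" unfolding 1 s word_pow_def by simp
    moreover have "[j + (p ^ 2 - 1) + 1 = j] (mod p ^ 2)"
      using pos(2) by (simp add: cong_add_lcancel_0_nat cong_0_iff)
    moreover have "[(i' * r' + 1) * (1 + p) = i + p] (mod p ^ 3)"
    proof -
      have "(i' * r' + 1) * (1 + p) = i' * (r' * (1 + p)) + (1 + p)" by (simp add: algebra_simps)
      also have "[\<dots> = i' * 1 + (1 + p)] (mod p ^ 3)"
        by (intro cong_add cong_refl cong_scalar_left r')
      also have "i' * 1 + (1 + p) = (i + p) + p ^ 3" unfolding i'_def using pos(1) by simp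
      also have "[(i + p) + p ^ 3 = i + p] (mod p ^ 3)" by (simp add: cong_def)
      finally show ?thesis .
    qed
    ultimately show ?thesis by (simp only: exp_cong_def fst_conv snd_conv simp_thms)
  next
    case 2
    show ?thesis unfolding 2 s word_pow_def fold_phi8_act_replicate by (simp add: exp_cong_refl)
  next
    case 3
    have "[i + p ^ 2 * p = i] (mod p ^ 3)" by (simp add: cong_add_lcancel_0_nat cong_0_iff power3_eq_cube power2_eq_square)
    then show ?thesis unfolding 3 s word_pow_def fold_phi8_act_replicate by (simp add: exp_cong_def)
  next
    case 4
    have "[i * (1 + p) ^ (p ^ 2) = i] (mod p ^ 3)"
      using cong_scalar_left[OF power_cong_one[OF assms(1)], of i] by simp
    then show ?thesis unfolding 4 s word_pow_def fold_phi8_act_replicate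
      by (simp add: exp_cong_def cong_add_lcancel_0_nat cong_0_iff)
  qed
qed

text \<open>The start state is left arbitrary because concatenation runs the second words from
  states that are only congruent, not equal.\<close>

lemma pres_eq_imp_exp_cong:
  assumes "pres_eq (Phi8_relations p) u v" and "odd p"
  shows "exp_cong p (fold (phi8_act p) u s) (fold (phi8_act p) v s)"
  using assms(1)
proof (induction arbitrary: s)
  case (relation u v)
  then show ?case by (rule phi8_act_relation[OF assms(2)])
next
  case (cancel g b)
  then show ?case using phi8_act_cancel[OF assms(2)] by simp
next
  case (refl u)
  then show ?case by (rule exp_cong_refl)
next
  case (sym u v)
  then show ?case by (blast intro: exp_cong_sym)
next
  case (trans u v w)
  then show ?case by (blast intro: exp_cong_trans)
next
  case (append u u' v v')
  have "exp_cong p (fold (phi8_act p) v (fold (phi8_act p) u s)) (fold (phi8_act p) v (fold (phi8_act p) u' s))"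
    by (rule fold_phi8_act_cong[OF append.IH(1)])
  from exp_cong_trans[OF this append.IH(2)] show ?case by simp
qed

section \<open>Normal forms in the presented group\<close>

lemma presented_group_pow:
  "pres_class R [a] [^]\<^bsub>presented_group R\<^esub> (n :: nat) = pres_class R (replicate n a)"
proof -
  interpret group "presented_group R" by (rule group_presented_group)
  show ?thesis
  proof (induction n)
    case (Suc n)
    then show ?case by (simp add: presented_group_mult replicate_append_same)
  qed (simp add: one_presented_group)
qed

lemma presented_group_inv:
  "inv\<^bsub>presented_group R\<^esub> (pres_class R [(a, True)]) = pres_class R [(a, False)]"
proof -
  interpret group "presented_group R" by (rule group_presented_group)
  have "pres_eq R [(a, False), (a, True)] []" using pres_eq.cancel[of R a False] by simp
  then show ?thesis
    by (intro inv_equality)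
      (auto simp: presented_group_mult one_presented_group pres_class_eq_iff carrier_presented_group)
qed

lemma presented_group_relation:
  "(u, v) \<in> R \<Longrightarrow> pres_class R u = pres_class R v"
  by (simp add: pres_class_eq_iff pres_eq.relation)

lemma metacyclic_Phi8_32:
  assumes "odd p"
  shows "metacyclic (Phi8_32 p) p
    (pres_class (Phi8_relations p) [(Alpha1, True)]) (pres_class (Phi8_relations p) [(Alpha2, True)])"
proof -
  define R where "R = Phi8_relations p"
  define x where "x = pres_class R [(Alpha1, True)]"
  define y where "y = pres_class R [(Alpha2, True)]"
  define b where "b = pres_class R [(Beta, True)]"
  define K where "K = presented_group R"
  interpret group K unfolding K_def by (rule group_presented_group)
  have cl [simp]: "pres_class R u \<in> carrier K" for u by (simp add: K_def carrier_presented_group)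
  have xyb [simp]: "x \<in> carrier K" "y \<in> carrier K" "b \<in> carrier K" by (simp_all add: x_def y_def b_def)
  have mult: "pres_class R u \<otimes>\<^bsub>K\<^esub> pres_class R v = pres_class R (u @ v)" for u v
    by (simp add: K_def presented_group_mult)
  have one: "pres_class R [] = \<one>\<^bsub>K\<^esub>" by (simp add: K_def one_presented_group)
  have pow: "x [^]\<^bsub>K\<^esub> n = pres_class R (replicate n (Alpha1, True))"
    "y [^]\<^bsub>K\<^esub> n = pres_class R (replicate n (Alpha2, True))"
    "b [^]\<^bsub>K\<^esub> n = pres_class R (replicate n (Beta, True))" for n :: nat
    by (simp_all add: K_def x_def y_def b_def presented_group_pow)
  have inv: "inv\<^bsub>K\<^esub> x = pres_class R [(Alpha1, False)]" "inv\<^bsub>K\<^esub> y = pres_class R [(Alpha2, False)]"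
    "inv\<^bsub>K\<^esub> b = pres_class R [(Beta, False)]"
    by (simp_all add: K_def x_def y_def b_def presented_group_inv)
  have rel: "(u, v) \<in> Phi8_relations p \<Longrightarrow> pres_class R u = pres_class R v" for u v
    by (simp add: R_def presented_group_relation)
  have b: "b = x [^]\<^bsub>K\<^esub> p"
    using rel[of "word_pow Beta 1" "word_pow Alpha1 p"]
    by (simp add: Phi8_relations_def word_pow_def b_def pow)
  have "b [^]\<^bsub>K\<^esub> (p ^ 2) = \<one>\<^bsub>K\<^esub>"
    using rel[of "word_pow Beta (p ^ 2)" "[]"]
    by (simp add: Phi8_relations_def word_pow_def pow one)
  then have xp: "x [^]\<^bsub>K\<^esub> (p ^ 3) = \<one>\<^bsub>K\<^esub>"
    unfolding b by (simp add: nat_pow_pow power2_eq_square power3_eq_cube mult.assoc)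
  have yp: "y [^]\<^bsub>K\<^esub> (p ^ 2) = \<one>\<^bsub>K\<^esub>"
    using rel[of "word_pow Alpha2 (p ^ 2)" "[]"]
    by (simp add: Phi8_relations_def word_pow_def pow one)
  have "inv\<^bsub>K\<^esub> x \<otimes>\<^bsub>K\<^esub> inv\<^bsub>K\<^esub> y \<otimes>\<^bsub>K\<^esub> x \<otimes>\<^bsub>K\<^esub> y = x [^]\<^bsub>K\<^esub> p"
    using rel[of "word_commutator Alpha1 Alpha2" "word_pow Beta 1"]
    unfolding inv b[symmetric]
    by (simp add: Phi8_relations_def word_pow_def word_commutator_def x_def y_def b_def mult)
  moreover have "inv\<^bsub>K\<^esub> x \<otimes>\<^bsub>K\<^esub> inv\<^bsub>K\<^esub> y \<otimes>\<^bsub>K\<^esub> x \<otimes>\<^bsub>K\<^esub> y = inv\<^bsub>K\<^esub> (y \<otimes>\<^bsub>K\<^esub> x) \<otimes>\<^bsub>K\<^esub> (x \<otimes>\<^bsub>K\<^esub> y)"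
    by (simp add: inv_mult_group m_assoc)
  moreover have "inv\<^bsub>K\<^esub> (y \<otimes>\<^bsub>K\<^esub> x) \<otimes>\<^bsub>K\<^esub> (x \<otimes>\<^bsub>K\<^esub> y) = x [^]\<^bsub>K\<^esub> p \<longleftrightarrow>
      x \<otimes>\<^bsub>K\<^esub> y = y \<otimes>\<^bsub>K\<^esub> x \<otimes>\<^bsub>K\<^esub> x [^]\<^bsub>K\<^esub> p"
    by (rule inv_solve_left') simp_all
  ultimately have "x \<otimes>\<^bsub>K\<^esub> y = y \<otimes>\<^bsub>K\<^esub> x \<otimes>\<^bsub>K\<^esub> x [^]\<^bsub>K\<^esub> p" by simp
  also have "\<dots> = y \<otimes>\<^bsub>K\<^esub> x [^]\<^bsub>K\<^esub> Suc p" unfolding nat_pow_Suc2[OF xyb(1)] by (simp add: m_assoc)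
  finally have swap: "x \<otimes>\<^bsub>K\<^esub> y = y \<otimes>\<^bsub>K\<^esub> x [^]\<^bsub>K\<^esub> (1 + p)" by simp
  interpret metacyclic_relations K p x y
    by unfold_locales (use xp yp swap in simp_all)
  have pos: "p > 0" by (rule odd_pos[OF assms])
  have inv_pow: "inv\<^bsub>K\<^esub> z = z [^]\<^bsub>K\<^esub> (n - 1)"
    if "z \<in> carrier K" "z [^]\<^bsub>K\<^esub> n = \<one>\<^bsub>K\<^esub>" "n > 0" for z and n :: nat
  proof (rule inv_equality)
    have "z [^]\<^bsub>K\<^esub> (n - 1) \<otimes>\<^bsub>K\<^esub> z = z [^]\<^bsub>K\<^esub> Suc (n - 1)" by simp
    then show "z [^]\<^bsub>K\<^esub> (n - 1) \<otimes>\<^bsub>K\<^esub> z = \<one>\<^bsub>K\<^esub>" using that by simp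
  qed (use that in simp_all)
  \<comment> \<open>By the finite orders of the generators, inverse letters are natural powers too;
    \<open>Beta\<close> and its inverse become powers of \<open>x\<close>.\<close>
  have letter: "\<exists>(l :: nat) (k :: nat). pres_class R [a] = y [^]\<^bsub>K\<^esub> l \<otimes>\<^bsub>K\<^esub> x [^]\<^bsub>K\<^esub> k" for a
  proof -
    have X: "\<exists>(l :: nat) (k :: nat). x [^]\<^bsub>K\<^esub> n = y [^]\<^bsub>K\<^esub> l \<otimes>\<^bsub>K\<^esub> x [^]\<^bsub>K\<^esub> k" for n :: nat
      by (intro exI[of _ 0] exI[of _ n]) simp
    have Y: "\<exists>(l :: nat) (k :: nat). y [^]\<^bsub>K\<^esub> n = y [^]\<^bsub>K\<^esub> l \<otimes>\<^bsub>K\<^esub> x [^]\<^bsub>K\<^esub> k" for n :: nat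
      by (intro exI[of _ n] exI[of _ 0]) simp
    obtain g s where a: "a = (g, s)" by (cases a)
    have "inv\<^bsub>K\<^esub> x = x [^]\<^bsub>K\<^esub> (p ^ 3 - 1)" "inv\<^bsub>K\<^esub> y = y [^]\<^bsub>K\<^esub> (p ^ 2 - 1)"
      using xp yp pos by (simp_all add: inv_pow)
    moreover have "inv\<^bsub>K\<^esub> b = x [^]\<^bsub>K\<^esub> (p * (p ^ 2 - 1))"
      using inv_pow[OF _ \<open>b [^]\<^bsub>K\<^esub> (p ^ 2) = \<one>\<^bsub>K\<^esub>\<close>] pos by (simp add: b nat_pow_pow)
    moreover have "x = x [^]\<^bsub>K\<^esub> (1 :: nat)" "y = y [^]\<^bsub>K\<^esub> (1 :: nat)" by simp_all
    ultimately show ?thesis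
      using X Y b inv unfolding a by (cases g; cases s) (metis b_def x_def y_def)+
  qed
  have nf: "\<exists>(j :: nat) (i :: nat). pres_class R w = y [^]\<^bsub>K\<^esub> j \<otimes>\<^bsub>K\<^esub> x [^]\<^bsub>K\<^esub> i" for w
  proof (induction w rule: rev_induct)
    case Nil
    show ?case
      by (intro exI[of _ 0]) (simp add: one)
  next
    case (snoc a w)
    then obtain j i l k :: nat where "pres_class R w = y [^]\<^bsub>K\<^esub> j \<otimes>\<^bsub>K\<^esub> x [^]\<^bsub>K\<^esub> i"
      and "pres_class R [a] = y [^]\<^bsub>K\<^esub> l \<otimes>\<^bsub>K\<^esub> x [^]\<^bsub>K\<^esub> k"
      using letter by metis
    then have "pres_class R (w @ [a]) = y [^]\<^bsub>K\<^esub> (j + l) \<otimes>\<^bsub>K\<^esub> x [^]\<^bsub>K\<^esub> (i * (1 + p) ^ l + k)"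
      by (simp only: mult[symmetric] normal_form_mult)
    then show ?case by blast
  qed
  have "metacyclic K p x y"
  proof unfold_locales
    show "odd p" by (rule assms)
    fix g assume "g \<in> carrier K"
    then obtain w where "g = pres_class R w" unfolding K_def carrier_presented_group by blast
    then show "\<exists>(j :: nat) (i :: nat). g = y [^]\<^bsub>K\<^esub> j \<otimes>\<^bsub>K\<^esub> x [^]\<^bsub>K\<^esub> i" using nf by simp
  next
    fix i j k l :: nat
    assume "y [^]\<^bsub>K\<^esub> j \<otimes>\<^bsub>K\<^esub> x [^]\<^bsub>K\<^esub> i = y [^]\<^bsub>K\<^esub> l \<otimes>\<^bsub>K\<^esub> x [^]\<^bsub>K\<^esub> k"
    then have "pres_eq R (replicate j (Alpha2, True) @ replicate i (Alpha1, True))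
        (replicate l (Alpha2, True) @ replicate k (Alpha1, True))"
      by (simp add: pow mult pres_class_eq_iff)
    \<comment> \<open>Started at (0, 0), the action reads off the exponents: the
      \<open>Alpha2\<close> letters only multiply the second entry 0, and the \<open>Alpha1\<close>
      letters then count up from it.\<close>
    moreover have "fold (phi8_act p) (replicate j (Alpha2, True) @ replicate i (Alpha1, True)) (0, 0) = (j, i)"
      for j i by (simp only: fold_append o_apply fold_phi8_act_replicate) simp
    ultimately show "[j = l] (mod p ^ 2) \<and> [i = k] (mod p ^ 3)"
      using pres_eq_imp_exp_cong[OF _ assms, of _ _ "(0, 0)"] unfolding R_def
      by (metis exp_cong_def fst_conv snd_conv)
  qed
  then show ?thesis unfolding K_def x_def y_def R_def Phi8_32_def .
qed

section \<open>Generating functions\<close>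

lemma fps_geometric: "fps_const a / (1 - fps_const (c :: real) * fps_X) = Abs_fps (\<lambda>n. a * c ^ n)"
proof -
  have "(1 - fps_const c * fps_X) * Abs_fps (\<lambda>n. a * c ^ n) = fps_const a"
  proof (rule fps_ext)
    fix n
    show "fps_nth ((1 - fps_const c * fps_X) * Abs_fps (\<lambda>n. a * c ^ n)) n = fps_nth (fps_const a) n"
      by (cases n) (simp_all add: left_diff_distrib mult.assoc)
  qed
  moreover have "1 - fps_const c * fps_X \<noteq> 0"
  proof
    assume "1 - fps_const c * fps_X = 0"
    then have "fps_nth (1 - fps_const c * fps_X) 0 = 0" by simp
    then show False by simp
  qed
  ultimately show ?thesis by (metis nonzero_mult_div_cancel_left)
qed

text \<open>With |G| = z p^4, where z is the order of the centre, division by |G|^n cancels every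
  power of z and leaves an expression in p alone.\<close>

lemma Phi8_counts:
  fixes G :: "('a, 'b) monoid_scheme"
  assumes p: "Factorial_Ring.prime p" and odd: "odd p" and "group G" and fin: "finite (carrier G)"
    and iso: "isoclinic G (Phi8_32 p)"
  defines "q \<equiv> inverse (real p)"
  shows "real (alpha G n) / real (order G) ^ n =
      (1 - q ^ 2) * (q ^ 2) ^ n + (q ^ 2 - q ^ 4) * q ^ n + q ^ 4"
    and "real (beta G n) / real (order G) ^ n =
      (- q - q ^ 2) * (q ^ 3) ^ n + (1 + q + q ^ 2) * (q ^ 2) ^ n"
proof -
  interpret group G by fact
  interpret K: metacyclic "Phi8_32 p" p
    "pres_class (Phi8_relations p) [(Alpha1, True)]" "pres_class (Phi8_relations p) [(Alpha2, True)]"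
    by (rule metacyclic_Phi8_32[OF odd])
  obtain f where f: "f ` carrier G = residue_pairs p"
    "\<And>v. v \<in> residue_pairs p \<Longrightarrow> card {x \<in> carrier G. f x = v} = card (group_center G)"
    "\<And>x y. x \<in> carrier G \<Longrightarrow> y \<in> carrier G \<Longrightarrow> x \<otimes>\<^bsub>G\<^esub> y = y \<otimes>\<^bsub>G\<^esub> x \<longleftrightarrow> det_cong p (f x) (f y)"
    using isoclinic_centre_map[OF \<open>group G\<close> K.is_group fin iso K.coords_surj
        K.center_coset_iff K.commute_iff_coords] by blast
  define z where "z = real (card (group_center G))"
  define P where "P = real p"
  have P: "P > 1" unfolding P_def using prime_gt_1_nat[OF p] by simp
  have q: "q = 1 / P" by (simp add: q_def P_def inverse_eq_divide)
  note counts = counts_of_centre_map[where f = f, OF fin f]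
  have order: "real (order G) = z * P ^ 4"
    using counts(1) by (simp add: card_residue_pairs z_def P_def)
  have "order G > 0" using fin by (simp add: order_gt_0_iff_finite)
  then have "z * P ^ 4 > 0" unfolding order[symmetric] by simp
  then have z: "z > 0" using P by (simp add: zero_less_mult_iff)
  \<comment> \<open>One factor \<open>P ^ 4\<close> comes from the order in Burnside's lemma, the
    other \<open>n\<close> from the division by the powers of the order.\<close>
  have ratio: "a / real (order G) ^ n = S / (P ^ 4 * (P ^ 4) ^ n)"
    if "a * (z * P ^ 4) = z ^ Suc n * S" for a S
  proof -
    have "z * (a * P ^ 4) = z * (z ^ n * S)" using that by (simp add: ac_simps)
    then have "a = z ^ n * S / P ^ 4" using z P by (simp add: eq_divide_eq)
    then show ?thesis unfolding order power_mult_distrib using z by simp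
  qed
  have le: "p ^ 2 \<le> p ^ 4" "1 \<le> p ^ 2"
    using prime_gt_0_nat[OF p] by (auto intro: power_increasing)
  have "real (alpha G n) * (z * P ^ 4) = z ^ Suc n *
      ((P ^ 4 - P ^ 2) * (P ^ 2) ^ n + (P ^ 2 - 1) * (P ^ 3) ^ n + (P ^ 4) ^ n)"
    using arg_cong[OF counts(2)[of n], of real] le
    unfolding sum_card_det_cong[OF p] of_nat_mult order
    by (simp add: z_def P_def of_nat_diff)
  from ratio[OF this] have "real (alpha G n) / real (order G) ^ n =
      ((P ^ 4 - P ^ 2) * (P ^ 2) ^ n + (P ^ 2 - 1) * (P ^ 3) ^ n + (P ^ 4) ^ n) / (P ^ 4 * (P ^ 4) ^ n)" .
  also have "\<dots> = (P ^ 4 - P ^ 2) / P ^ 4 * (P ^ 2 / P ^ 4) ^ n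
      + (P ^ 2 - 1) / P ^ 4 * (P ^ 3 / P ^ 4) ^ n + 1 / P ^ 4"
    using P by (simp add: add_divide_distrib power_divide)
  also have "\<dots> = (1 - q ^ 2) * (q ^ 2) ^ n + (q ^ 2 - q ^ 4) * q ^ n + q ^ 4"
  proof -
    have "(P ^ 4 - P ^ 2) / P ^ 4 = 1 - q ^ 2" "(P ^ 2 - 1) / P ^ 4 = q ^ 2 - q ^ 4"
      "P ^ 2 / P ^ 4 = q ^ 2" "P ^ 3 / P ^ 4 = q" "1 / P ^ 4 = q ^ 4"
      using P unfolding q by (simp_all add: field_simps power2_eq_square power3_eq_cube power4_eq_xxxx)
    then show ?thesis by simp
  qed
  finally show "real (alpha G n) / real (order G) ^ n =
      (1 - q ^ 2) * (q ^ 2) ^ n + (q ^ 2 - q ^ 4) * q ^ n + q ^ 4" .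
  have "real (beta G n) * (z * P ^ 4) = z ^ Suc n *
      ((1 + P + P ^ 2) * (P ^ 2) ^ Suc n - (P + P ^ 2) * P ^ Suc n)"
    using arg_cong[OF counts(3)[of n], of real]
    unfolding of_nat_mult order card_related_lists_det_cong[OF p]
    by (simp add: z_def P_def)
  from ratio[OF this] have "real (beta G n) / real (order G) ^ n =
      ((1 + P + P ^ 2) * (P ^ 2) ^ Suc n - (P + P ^ 2) * P ^ Suc n) / (P ^ 4 * (P ^ 4) ^ n)" .
  \<comment> \<open>The tuples have length \<open>Suc n\<close>, so one factor of each power moves
    into the coefficient.\<close>
  also have "\<dots> = - ((P + P ^ 2) * P / P ^ 4) * (P / P ^ 4) ^ n
      + (1 + P + P ^ 2) * P ^ 2 / P ^ 4 * (P ^ 2 / P ^ 4) ^ n"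
    using P by (simp add: diff_divide_distrib power_divide)
  also have "\<dots> = (- q - q ^ 2) * (q ^ 3) ^ n + (1 + q + q ^ 2) * (q ^ 2) ^ n"
  proof -
    have "- ((P + P ^ 2) * P / P ^ 4) = - q - q ^ 2" "(1 + P + P ^ 2) * P ^ 2 / P ^ 4 = 1 + q + q ^ 2"
      "P ^ 2 / P ^ 4 = q ^ 2" "P / P ^ 4 = q ^ 3"
      using P unfolding q by (simp_all add: field_simps power2_eq_square power3_eq_cube power4_eq_xxxx)
    then show ?thesis by simp
  qed
  finally show "real (beta G n) / real (order G) ^ n =
      (- q - q ^ 2) * (q ^ 3) ^ n + (1 + q + q ^ 2) * (q ^ 2) ^ n" .
qed

theorem lemma5p7:
  fixes G :: "('a, 'b) monoid_scheme" and p m :: nat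
  assumes "Factorial_Ring.prime p" and "odd p"
    and "p_group p G" and "order G = p ^ m"
    and "isoclinism_rank p G = 5"
    and "in_Phi8 p G"
  shows "fps_compose (A_series G) (fps_const (1 / real (order G)) * fps_X) =
             fps_const (1 - real p powi -2) / (1 - fps_const (real p powi -2) * fps_X)
           + fps_const (real p powi -2 - real p powi -4) / (1 - fps_const (real p powi -1) * fps_X)
           + fps_const (real p powi -4) / (1 - fps_X)
       \<and> fps_compose (B_series G) (fps_const (1 / real (order G)) * fps_X) =
             fps_const (- (real p powi -1) - real p powi -2)
               / (1 - fps_const (real p powi -3) * fps_X)
           + fps_const (1 + real p powi -1 + real p powi -2)
               / (1 - fps_const (real p powi -2) * fps_X)"
proof -
  define q where "q = inverse (real p)"
  have powi: "real p powi -1 = q" "real p powi -2 = q ^ 2" "real p powi -3 = q ^ 3" "real p powi -4 = q ^ 4"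
    by (simp_all add: q_def power_int_minus power_inverse)
  \<comment> \<open>Writing the ratio 1 explicitly brings the last summand of A under
    \<open>fps_geometric\<close>.\<close>
  have one: "1 - fps_X = 1 - fps_const (1 :: real) * fps_X" by simp
  have G: "group G" using assms(3) by (simp add: p_group_def)
  have "order G > 0" unfolding assms(4) using prime_gt_0_nat[OF assms(1)] by simp
  then have fin: "finite (carrier G)" by (simp add: order_def card_gt_0_iff)
  note counts = Phi8_counts[OF assms(1,2) G fin, folded q_def]
  have iso: "isoclinic G (Phi8_32 p)" using assms(6) by (simp add: in_Phi8_def)
  \<comment> \<open>Substituting c X scales the n-th coefficient by c^n, so both identities are
    compared coefficientwise with \<open>Phi8_counts\<close>.\<close>
  show ?thesis
    unfolding powi one fps_geometric
    by (auto simp: fps_eq_iff A_series_def B_series_def power_divide counts[OF iso])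
qed

end
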